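(* Assuming the Orthogonal Vectors Conjecture, for no $\epsilon>0$ is there an algorithm with running time $O(m^{2-\epsilon})$ or $O((k\cdot m)^{1-\epsilon})$ for computing the almost-sure winning set of disjunctive safety objectives or of disjunctive safety queries with $k$ target sets in MDPs with $m$ edges. In particular, there is no such algorithm deciding whether the winning set is non-empty or deciding whether a specific vertex is in the winning set.
   Context: An MDP $P=((V,E),(V_1,V_R),\delta)$: finite directed graph, vertices partitioned into player-1 vertices $V_1$ and random vertices $V_R$, each $v\in V_R$ with a probability distribution over its out-neighbours (positive on each). Player-1 strategies choose successors at $V_1$ vertices based on the history. $\langle\langle 1\rangle\rangle_{as}(P,\psi)$ is the set of vertices from which player 1 can satisfy $\psi$ with probability 1. $\mathrm{Safety}(T)$: plays never visiting $T$. Disjunctive objective: $\langle\langle 1\rangle\rangle_{as}(P,\bigcup_i\mathrm{Safety}(T_i))$; disjunctive query: $\bigcup_i\langle\langle 1\rangle\rangle_{as}(P,\mathrm{Safety}(T_i))$. Orthogonal Vectors Conjecture: there is no $O(N^{2-\epsilon})$ algorithm, for any $\epsilon>0$, that, given two sets $S_1,S_2$ of at most $N$ vectors in $\{0,1\}^d$ with $d\in\Theta(\log N)$, decides whether some $u\in S_1,v\in S_2$ satisfy $\sum_i u_iv_i=0$. *)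

theory Defs
  imports "HOL-Probability.Probability" "HOL-Library.Landau_Symbols"
begin

section \<open>Markov decision processes\<close>

record 'v mdp =
  verts :: "'v set"
  edges :: "('v \<times> 'v) set"
  player1 :: "'v set"
  random :: "'v set"
  delta :: "'v \<Rightarrow> 'v pmf"

text \<open>Every vertex has a successor, so that all plays are infinite; for random vertices this already
  follows from the condition on the support.\<close>

definition is_mdp :: "'v mdp \<Rightarrow> bool" where
  "is_mdp P \<longleftrightarrow>
     finite (verts P) \<and> edges P \<subseteq> verts P \<times> verts P \<and>
     player1 P \<union> random P = verts P \<and> player1 P \<inter> random P = {} \<and>
     (\<forall>u\<in>verts P. \<exists>v. (u, v) \<in> edges P) \<and>
     (\<forall>u\<in>random P. set_pmf (delta P u) = {v. (u, v) \<in> edges P})"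

definition is_strategy :: "'v mdp \<Rightarrow> ('v list \<Rightarrow> 'v) \<Rightarrow> bool" where
  "is_strategy P \<sigma> \<longleftrightarrow>
     (\<forall>h. h \<noteq> [] \<and> set h \<subseteq> verts P \<and> last h \<in> player1 P \<longrightarrow> (last h, \<sigma> h) \<in> edges P)"

text \<open>Distribution of the \<open>i\<close>-th vertex of a play that starts in \<open>v\<close>, given the vertices
  \<open>\<omega> 0, \<dots>, \<omega> (i - 1)\<close>.\<close>

definition play_kernel ::
  "'v mdp \<Rightarrow> ('v list \<Rightarrow> 'v) \<Rightarrow> 'v \<Rightarrow> nat \<Rightarrow> (nat \<Rightarrow> 'v) \<Rightarrow> 'v measure" where
  "play_kernel P \<sigma> v i \<omega> = measure_pmf
     (if i = 0 then return_pmf v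
      else let h = map \<omega> [0..<i] in
        if last h \<in> player1 P then return_pmf (\<sigma> h) else delta P (last h))"

text \<open>The measure on plays obtained from the kernels by the Ionescu-Tulcea theorem.\<close>

definition play_measure ::
  "'v::countable mdp \<Rightarrow> ('v list \<Rightarrow> 'v) \<Rightarrow> 'v \<Rightarrow> (nat \<Rightarrow> 'v) measure" where
  "play_measure P \<sigma> v = projective_family.lim UNIV
     (Ionescu_Tulcea.CI (play_kernel P \<sigma> v) (\<lambda>_. count_space UNIV)) (\<lambda>_. count_space UNIV)"

lemma Ionescu_Tulcea_play_kernel:
  fixes P :: "'v::countable mdp"
  shows "Ionescu_Tulcea (play_kernel P \<sigma> v) (\<lambda>_. count_space UNIV)"
proof (rule Ionescu_Tulcea.intro)
  fix i :: nat
  show "play_kernel P \<sigma> v i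
      \<in> Pi\<^sub>M {0..<i} (\<lambda>_. count_space UNIV) \<rightarrow>\<^sub>M subprob_algebra (count_space UNIV)"
    by (subst count_space_PiM_finite)
      (auto simp: play_kernel_def measure_pmf_in_subprob_algebra)
next
  fix i :: nat and x :: "nat \<Rightarrow> 'v"
  show "prob_space (play_kernel P \<sigma> v i x)"
    unfolding play_kernel_def by (rule prob_space_measure_pmf)
qed

definition almost_sure_win :: "'v::countable mdp \<Rightarrow> (nat \<Rightarrow> 'v) set \<Rightarrow> 'v set" where
  "almost_sure_win P \<psi> =
     {v \<in> verts P. \<exists>\<sigma>. is_strategy P \<sigma> \<and> measure (play_measure P \<sigma> v) \<psi> = 1}"

definition Safety :: "'v set \<Rightarrow> (nat \<Rightarrow> 'v) set" where
  "Safety T = {\<omega>. \<forall>i. \<omega> i \<notin> T}"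

definition disj_objective_win :: "'v::countable mdp \<Rightarrow> 'v set list \<Rightarrow> 'v set" where
  "disj_objective_win P Ts = almost_sure_win P (\<Union>T\<in>set Ts. Safety T)"

definition disj_query_win :: "'v::countable mdp \<Rightarrow> 'v set list \<Rightarrow> 'v set" where
  "disj_query_win P Ts = (\<Union>T\<in>set Ts. almost_sure_win P (Safety T))"


section \<open>Word RAM\<close>

text \<open>Algorithms are word RAM programs: finitely many registers, a random-access memory, unit-cost
  instructions, and words of \<open>O(log s)\<close> bits, where \<open>s\<close> bounds the length and the entries of the
  input. \<open>exec W p s t s'\<close> means that \<open>p\<close> takes state \<open>s\<close> to state \<open>s'\<close> in \<open>t\<close> steps while computing
  only values below \<open>W\<close>; a program whose computation overflows has no execution.\<close>

datatype binop =
  Plus | Minus | Times | Div | Mod | BitAnd | BitOr | BitXor | ShiftL | ShiftR | Less | Equal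

fun binop_val :: "binop \<Rightarrow> nat \<Rightarrow> nat \<Rightarrow> nat" where
  "binop_val Plus a b = a + b"
| "binop_val Minus a b = a - b"
| "binop_val Times a b = a * b"
| "binop_val Div a b = a div b"
| "binop_val Mod a b = a mod b"
| "binop_val BitAnd a b = Bit_Operations.and a b"
| "binop_val BitOr a b = Bit_Operations.or a b"
| "binop_val BitXor a b = Bit_Operations.xor a b"
| "binop_val ShiftL a b = push_bit b a"
| "binop_val ShiftR a b = drop_bit b a"
| "binop_val Less a b = (if a < b then 1 else 0)"
| "binop_val Equal a b = (if a = b then 1 else 0)"

datatype prog =
    Skip
  | Const nat nat              \<comment> \<open>\<open>Const r n\<close>: register \<open>r\<close> := \<open>n\<close>\<close>
  | Op binop nat nat nat       \<comment> \<open>\<open>Op f r a b\<close>: register \<open>r\<close> := \<open>f\<close> of registers \<open>a\<close>, \<open>b\<close>\<close>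
  | Load nat nat               \<comment> \<open>\<open>Load r a\<close>: register \<open>r\<close> := memory at the address in register \<open>a\<close>\<close>
  | Store nat nat              \<comment> \<open>\<open>Store a b\<close>: memory at the address in register \<open>a\<close> := register \<open>b\<close>\<close>
  | Seq prog prog
  | If nat prog prog           \<comment> \<open>the test is that the register is nonzero\<close>
  | While nat prog

type_synonym ram_state = "(nat \<Rightarrow> nat) \<times> (nat \<Rightarrow> nat)"  \<comment> \<open>registers and memory\<close>

inductive exec :: "nat \<Rightarrow> prog \<Rightarrow> ram_state \<Rightarrow> nat \<Rightarrow> ram_state \<Rightarrow> bool" for W :: nat where
  Skip: "exec W Skip s 1 s"
| Const: "n < W \<Longrightarrow> exec W (Const r n) (R, M) 1 (R(r := n), M)"
| Op: "binop_val f (R a) (R b) < W \<Longrightarrow>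
    exec W (Op f r a b) (R, M) 1 (R(r := binop_val f (R a) (R b)), M)"
| Load: "exec W (Load r a) (R, M) 1 (R(r := M (R a)), M)"
| Store: "exec W (Store a b) (R, M) 1 (R, M(R a := R b))"
| Seq: "exec W p s t s' \<Longrightarrow> exec W q s' t' s'' \<Longrightarrow> exec W (Seq p q) s (t + t') s''"
| IfTrue: "fst s r \<noteq> 0 \<Longrightarrow> exec W p s t s' \<Longrightarrow> exec W (If r p q) s (Suc t) s'"
| IfFalse: "fst s r = 0 \<Longrightarrow> exec W q s t s' \<Longrightarrow> exec W (If r p q) s (Suc t) s'"
| WhileFalse: "fst s r = 0 \<Longrightarrow> exec W (While r p) s 1 s"
| WhileTrue: "fst s r \<noteq> 0 \<Longrightarrow> exec W p s t s' \<Longrightarrow> exec W (While r p) s' t' s'' \<Longrightarrow>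
    exec W (While r p) s (Suc (t + t')) s''"

definition initial_state :: "nat list \<Rightarrow> ram_state" where
  "initial_state xs = ((\<lambda>_. 0)(0 := length xs), \<lambda>i. if i < length xs then xs ! i else 0)"

definition output_of :: "ram_state \<Rightarrow> nat list" where
  "output_of s = map (snd s) [0..<fst s 0]"

definition word_bound :: "nat \<Rightarrow> nat list \<Rightarrow> nat" where
  "word_bound c xs = (2 + length xs + Max (insert 0 (set xs))) ^ c"

text \<open>The program \<open>A\<close>, with word-size constant \<open>c\<close>, produces on each encoding \<open>xs\<close> of each
  instance \<open>x\<close> a correct output within \<open>bound x xs\<close> steps.\<close>

definition solves_within ::
  "prog \<Rightarrow> nat \<Rightarrow> ('i \<Rightarrow> nat list \<Rightarrow> bool) \<Rightarrow> ('i \<Rightarrow> nat list \<Rightarrow> bool) \<Rightarrow>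
   ('i \<Rightarrow> nat list \<Rightarrow> real) \<Rightarrow> bool" where
  "solves_within A c encodes correct bound \<longleftrightarrow>
     (\<forall>x xs. encodes x xs \<longrightarrow>
        (\<exists>t s. exec (word_bound c xs) A (initial_state xs) t s \<and>
               correct x (output_of s) \<and> real t \<le> bound x xs))"

definition answer :: "bool \<Rightarrow> nat list" where
  "answer b = [if b then 1 else 0]"


section \<open>Orthogonal vectors\<close>

definition encodes_OV ::
  "nat \<Rightarrow> nat list set \<Rightarrow> nat list set \<Rightarrow> nat list \<Rightarrow> bool" where
  "encodes_OV d S1 S2 xs \<longleftrightarrow>
     S1 \<union> S2 \<subseteq> {u. length u = d \<and> set u \<subseteq> {0, 1}} \<and>
     (\<exists>us vs. distinct us \<and> set us = S1 \<and> distinct vs \<and> set vs = S2 \<and>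
        xs = [d, length us, length vs] @ concat us @ concat vs)"

definition orthogonal_pair :: "nat \<Rightarrow> nat list set \<Rightarrow> nat list set \<Rightarrow> bool" where
  "orthogonal_pair d S1 S2 \<longleftrightarrow> (\<exists>u\<in>S1. \<exists>v\<in>S2. (\<Sum>i<d. u ! i * v ! i) = 0)"

text \<open>A single algorithm has to handle every dimension \<open>d \<in> \<Theta>(log N)\<close>, with the constant hidden in
  \<open>O(N\<^sup>2\<^sup>-\<^sup>\<epsilon>)\<close> depending on that of \<open>d\<close>. (For a fixed \<open>d \<in> \<Theta>(log N)\<close> with a small constant
  a subquadratic algorithm exists, since there are only \<open>2^d\<close> vectors.)\<close>

definition orthogonal_vectors_conjecture :: bool where
  "orthogonal_vectors_conjecture \<longleftrightarrow>
     \<not> (\<exists>\<epsilon>>0. \<exists>A c. \<forall>d :: nat \<Rightarrow> nat. (\<lambda>N. real (d N)) \<in> \<Theta>(\<lambda>N. ln (real N)) \<longrightarrow>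
          (\<exists>f :: nat \<Rightarrow> real. f \<in> O(\<lambda>N. real N powr (2 - \<epsilon>)) \<and>
             solves_within A c
               (\<lambda>(N, S1, S2) xs. card S1 \<le> N \<and> card S2 \<le> N \<and> encodes_OV (d N) S1 S2 xs)
               (\<lambda>(N, S1, S2) out. out = answer (orthogonal_pair (d N) S1 S2))
               (\<lambda>(N, S1, S2) xs. f N)))"


section \<open>Algorithms for disjunctive safety\<close>

text \<open>Input format: numbers of vertices, edges and target sets; one entry per vertex that is 1 for
  player-1 and 0 for random vertices; the edges in any order as quadruples \<open>u, v, a, b\<close> where
  \<open>a / b\<close> is the probability of \<open>v\<close> at a random vertex \<open>u\<close> (and \<open>a = b = 0\<close> at a player-1 vertex);
  each target set as its size followed by its elements.\<close>

definition encodes_instance :: "nat mdp \<Rightarrow> nat set list \<Rightarrow> nat list \<Rightarrow> bool" where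
  "encodes_instance P Ts xs \<longleftrightarrow>
     is_mdp P \<and> (\<forall>T\<in>set Ts. T \<subseteq> verts P) \<and>
     (\<exists>n es ts. verts P = {..<n} \<and>
        distinct (map (\<lambda>(u, v, a, b). (u, v)) es) \<and>
        edges P = (\<lambda>(u, v, a, b). (u, v)) ` set es \<and>
        (\<forall>(u, v, a, b)\<in>set es.
           if u \<in> random P then b \<noteq> 0 \<and> pmf (delta P u) v = real a / real b else a = 0 \<and> b = 0) \<and>
        list_all2 (\<lambda>T t. distinct t \<and> set t = T) Ts ts \<and>
        xs = [n, length es, length Ts]
           @ map (\<lambda>u. if u \<in> player1 P then 1 else 0) [0..<n]
           @ concat (map (\<lambda>(u, v, a, b). [u, v, a, b]) es)
           @ concat (map (\<lambda>t. length t # t) ts))"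

text \<open>\<open>win\<close> is the winning-set operator; \<open>bound\<close> depends on the number of edges, the number of
  target sets and the input length. The input length is available so that time linear in it can be
  granted on top of a bound in the other two parameters: \<open>(k \<cdot> m)\<^sup>1\<^sup>-\<^sup>\<epsilon>\<close> is sublinear in \<open>m\<close>
  for \<open>k = 1\<close>, and \<open>k\<close> target sets need not have a description of size \<open>O(m)\<close>, so that otherwise merely
  reading the input could exceed the bound.\<close>

definition computes_winning_set ::
  "(nat mdp \<Rightarrow> nat set list \<Rightarrow> nat set) \<Rightarrow> prog \<Rightarrow> nat \<Rightarrow> (nat \<Rightarrow> nat \<Rightarrow> nat \<Rightarrow> real) \<Rightarrow> bool" where
  "computes_winning_set win A c bound \<longleftrightarrow>
     solves_within A c (\<lambda>(P, Ts) xs. encodes_instance P Ts xs)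
       (\<lambda>(P, Ts) out. set out = win P Ts)
       (\<lambda>(P, Ts) xs. bound (card (edges P)) (length Ts) (length xs))"

definition decides_nonempty ::
  "(nat mdp \<Rightarrow> nat set list \<Rightarrow> nat set) \<Rightarrow> prog \<Rightarrow> nat \<Rightarrow> (nat \<Rightarrow> nat \<Rightarrow> nat \<Rightarrow> real) \<Rightarrow> bool" where
  "decides_nonempty win A c bound \<longleftrightarrow>
     solves_within A c (\<lambda>(P, Ts) xs. encodes_instance P Ts xs)
       (\<lambda>(P, Ts) out. out = answer (win P Ts \<noteq> {}))
       (\<lambda>(P, Ts) xs. bound (card (edges P)) (length Ts) (length xs))"

definition decides_membership ::
  "(nat mdp \<Rightarrow> nat set list \<Rightarrow> nat set) \<Rightarrow> prog \<Rightarrow> nat \<Rightarrow> (nat \<Rightarrow> nat \<Rightarrow> nat \<Rightarrow> real) \<Rightarrow> bool" where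
  "decides_membership win A c bound \<longleftrightarrow>
     solves_within A c
       (\<lambda>(P, Ts, v) xs. v \<in> verts P \<and> (\<exists>ys. encodes_instance P Ts ys \<and> xs = v # ys))
       (\<lambda>(P, Ts, v) out. out = answer (v \<in> win P Ts))
       (\<lambda>(P, Ts, v) xs. bound (card (edges P)) (length Ts) (length xs))"

end

theory Submission
  imports Defs
begin

text \<open>
  Orthogonal vectors reduce to disjunctive safety in almost linear time. Player 1 picks at the start
  vertex a vector \<open>u\<close> of the first set; a random vertex then moves to a coordinate at which \<open>u\<close> is 1
  (or to a harmless vertex), and the play returns to the start. Each vector \<open>v\<close> of the second set
  gives the target set of all coordinates at which \<open>v\<close> is 1. If \<open>u\<close> and \<open>v\<close> are orthogonal, always
  picking \<open>u\<close> avoids the target set of \<open>v\<close> surely. Otherwise every pick hits any given target set with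
  positive probability, so that against every strategy some finite play of positive probability
  hits all target sets, and no vertex wins even the disjunctive objective. Hence the
  winning set is non-empty iff it contains the start vertex iff there is an orthogonal pair.

  The MDP has \<open>O(N d)\<close> edges and at most \<open>N\<close> target sets, and a word RAM writes it down in time
  \<open>O(N d)\<close>. For \<open>d \<in> \<Theta>(log N)\<close> a running time \<open>O(m\<^sup>2\<^sup>-\<^sup>\<epsilon>)\<close> or \<open>O((k m)\<^sup>1\<^sup>-\<^sup>\<epsilon>)\<close>, even with time linear in
  the input length on top, would thus solve orthogonal vectors in time \<open>O(N\<^sup>2\<^sup>-\<^sup>\<delta>)\<close> for some \<open>\<delta> > 0\<close>.
\<close>

section \<open>Prefixes of plays\<close>

text \<open>The form of \<open>play_kernel\<close> that takes the history as a list, so that claims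
  about prefixes can be proved by induction on lists.\<close>

definition next_pmf :: "'v mdp \<Rightarrow> ('v list \<Rightarrow> 'v) \<Rightarrow> 'v \<Rightarrow> 'v list \<Rightarrow> 'v pmf" where
  "next_pmf P \<sigma> v h =
     (if h = [] then return_pmf v
      else if last h \<in> player1 P then return_pmf (\<sigma> h) else delta P (last h))"

text \<open>The histories of positive probability. As every step is discrete, an almost-sure
  property of prefixes amounts to a property of all of these.\<close>

inductive plausible :: "'v mdp \<Rightarrow> ('v list \<Rightarrow> 'v) \<Rightarrow> 'v \<Rightarrow> 'v list \<Rightarrow> bool"
  for P \<sigma> v where
  Nil: "plausible P \<sigma> v []"
| snoc: "plausible P \<sigma> v h \<Longrightarrow> y \<in> set_pmf (next_pmf P \<sigma> v h) \<Longrightarrow> plausible P \<sigma> v (h @ [y])"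

lemma play_kernel_eq:
  "play_kernel P \<sigma> v i \<omega> = measure_pmf (next_pmf P \<sigma> v (map \<omega> [0..<i]))"
  by (simp add: play_kernel_def next_pmf_def Let_def)

lemma plausible_snoc_iff:
  "plausible P \<sigma> v (h @ [y]) \<longleftrightarrow> plausible P \<sigma> v h \<and> y \<in> set_pmf (next_pmf P \<sigma> v h)"
  by (auto elim: plausible.cases intro: plausible.snoc)

text \<open>Stage \<open>Suc n\<close> is stage \<open>n\<close> bound with one further draw, and an
  almost-sure claim about a bind is a nested almost-sure claim. The inner one, over a
  \<open>pmf\<close>, quantifies over the support, exactly as \<open>plausible\<close> extends a
  history.\<close>

lemma AE_prefix_kernel_iff:
  fixes P :: "'v::countable mdp"
  shows "(AE x in Ionescu_Tulcea.C (play_kernel P \<sigma> v) (\<lambda>_. count_space UNIV) 0 n (\<lambda>_. undefined).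
            Q (map x [0..<n])) \<longleftrightarrow>
         (\<forall>h. plausible P \<sigma> v h \<longrightarrow> length h = n \<longrightarrow> Q h)"
proof (induction n arbitrary: Q)
  interpret IT: Ionescu_Tulcea "play_kernel P \<sigma> v" "\<lambda>_. count_space UNIV"
    by (rule Ionescu_Tulcea_play_kernel)
  {
    case 0
    have "prob_space (IT.C 0 0 (\<lambda>_. undefined))"
      by (rule IT.prob_space_C) (simp add: space_PiM)
    then show ?case
      by (auto simp del: IT.C.simps simp: prob_space.AE_const intro: plausible.Nil)
  next
    case (Suc n)
    let ?M = "\<lambda>n. PiM {0..<n} (\<lambda>_. count_space UNIV) :: (nat \<Rightarrow> 'v) measure"
    have Q: "Measurable.pred (?M (Suc n)) (\<lambda>x. Q (map x [0..<Suc n]))"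
      by (subst count_space_PiM_finite) auto
    have u: "(\<lambda>_. undefined) \<in> space (?M 0)"
      by (simp add: space_PiM)
    have eP: "IT.eP n \<in> IT.C 0 n (\<lambda>_. undefined) \<rightarrow>\<^sub>M subprob_algebra (?M (Suc n))"
      using IT.measurable_eP[of n] by (subst measurable_cong_sets[OF IT.sets_C[OF u, of n] refl]) simp
    have "(AE x in IT.C 0 (Suc n) (\<lambda>_. undefined). Q (map x [0..<Suc n])) \<longleftrightarrow>
      (AE x in IT.C 0 n (\<lambda>_. undefined). AE y in IT.eP n x. Q (map y [0..<Suc n]))"
      unfolding IT.C.simps add_0 by (rule AE_bind[OF eP Q])
    also have "\<dots> \<longleftrightarrow> (AE x in IT.C 0 n (\<lambda>_. undefined).
        \<forall>y\<in>set_pmf (next_pmf P \<sigma> v (map x [0..<n])). Q (map x [0..<n] @ [y]))"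
    proof (intro AE_cong)
      fix x assume "x \<in> space (IT.C 0 n (\<lambda>_. undefined))"
      then have x: "x \<in> space (?M n)"
        using IT.space_C[OF u, of n] by simp
      have upd: "map (x(n := y)) [0..<Suc n] = map x [0..<n] @ [y]" for y
        by simp
      have "(AE y in IT.eP n x. Q (map y [0..<Suc n])) \<longleftrightarrow>
          (AE y in play_kernel P \<sigma> v n x. Q (map (x(n := y)) [0..<Suc n]))"
        unfolding IT.eP_def
        using x by (intro AE_distr_iff) (auto simp: play_kernel_eq space_PiM PiE_def extensional_def count_space_PiM_finite)
      also have "\<dots> \<longleftrightarrow> (\<forall>y\<in>set_pmf (next_pmf P \<sigma> v (map x [0..<n])). Q (map x [0..<n] @ [y]))"
        by (simp only: play_kernel_eq AE_measure_pmf_iff upd)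
      finally show "(AE y in IT.eP n x. Q (map y [0..<Suc n])) \<longleftrightarrow>
        (\<forall>y\<in>set_pmf (next_pmf P \<sigma> v (map x [0..<n])). Q (map x [0..<n] @ [y]))" .
    qed
    also have "\<dots> \<longleftrightarrow> (\<forall>h. plausible P \<sigma> v h \<longrightarrow> length h = n \<longrightarrow>
        (\<forall>y\<in>set_pmf (next_pmf P \<sigma> v h). Q (h @ [y])))"
      by (rule Suc.IH)
    also have "\<dots> \<longleftrightarrow> (\<forall>h. plausible P \<sigma> v h \<longrightarrow> length h = Suc n \<longrightarrow> Q h)"
      by (metis length_append_singleton length_Suc_conv_rev plausible_snoc_iff)
    finally show ?case .
  }
qed

section \<open>Almost-sure properties of infinite plays\<close>

context
  fixes P :: "'v::countable mdp" and \<sigma> :: "'v list \<Rightarrow> 'v" and v :: 'v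
begin

interpretation IT: Ionescu_Tulcea "play_kernel P \<sigma> v" "\<lambda>_. count_space UNIV"
  by (rule Ionescu_Tulcea_play_kernel)

lemma sets_play_measure: "sets (play_measure P \<sigma> v) = sets (PiM UNIV (\<lambda>_. count_space UNIV))"
  by (simp add: play_measure_def)

lemma space_play_measure: "space (play_measure P \<sigma> v) = UNIV"
  by (simp add: play_measure_def space_PiM)

text \<open>The whole space is the cylinder over the empty index set, so its mass is that of
  \<open>CI {}\<close>, a probability measure.\<close>

lemma prob_space_play_measure: "prob_space (play_measure P \<sigma> v)"
proof (rule prob_spaceI)
  have "emeasure IT.PF.lim (IT.PF.emb UNIV {} (space (PiM {} (\<lambda>_. count_space UNIV)))) =
      emeasure (IT.CI {}) (space (IT.CI {}))"
    by (subst IT.lim) (auto simp: IT.CI_def)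
  also have "\<dots> = 1"
    using IT.PF.prob_space_P[of "{}"] by (simp add: prob_space.emeasure_space_1)
  also have "IT.PF.emb UNIV {} (space (PiM {} (\<lambda>_. count_space UNIV))) = UNIV"
    by (auto simp: prod_emb_def space_PiM)
  finally show "emeasure (play_measure P \<sigma> v) (space (play_measure P \<sigma> v)) = 1"
    by (simp add: space_play_measure) (simp add: play_measure_def)
qed

text \<open>Restricting the limit measure to the first \<open>n\<close> coordinates gives
  \<open>CI {0..<n}\<close>, which is the projection of stage \<open>up_to {0..<n}\<close>. Since
  that index is \<open>n\<close> itself, the finite statement \<open>AE_prefix_kernel_iff\<close>
  applies.\<close>

lemma AE_play_prefix_iff:
  "(AE \<omega> in play_measure P \<sigma> v. Q (map \<omega> [0..<n])) \<longleftrightarrow>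
   (\<forall>h. plausible P \<sigma> v h \<longrightarrow> length h = n \<longrightarrow> Q h)"
proof -
  let ?M = "PiM {0..<n} (\<lambda>_. count_space UNIV) :: (nat \<Rightarrow> 'v) measure"
  have up: "IT.up_to {0..<n} = n"
  proof (rule antisym)
    show "IT.up_to {0..<n} \<le> n" by (subst IT.up_to_iff) auto
    show "n \<le> IT.up_to {0..<n}"
    proof (cases n)
      case (Suc k)
      then show ?thesis using IT.up_to_less[of "{0..<n}" k] by simp
    qed simp
  qed
  have u: "(\<lambda>_. undefined) \<in> space (PiM {0..<0} (\<lambda>_. count_space UNIV) :: (nat \<Rightarrow> 'v) measure)"
    by (simp add: space_PiM)
  have Q: "{x \<in> space ?M. Q (map x [0..<n])} \<in> sets ?M"
    by (subst (1 2) count_space_PiM_finite) auto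
  have restr: "map (restrict x {0..<n}) [0..<n] = map x [0..<n]" for x :: "nat \<Rightarrow> 'v"
    by simp
  have "(AE \<omega> in play_measure P \<sigma> v. Q (map \<omega> [0..<n])) \<longleftrightarrow>
      (AE x in distr (play_measure P \<sigma> v) ?M (\<lambda>x. restrict x {0..<n}). Q (map x [0..<n]))"
    using Q measurable_cong_sets[OF sets_play_measure refl]
    by (subst AE_distr_iff) (auto simp only: restr intro!: measurable_restrict_subset)
  also have "distr (play_measure P \<sigma> v) ?M (\<lambda>x. restrict x {0..<n}) = IT.CI {0..<n}"
    unfolding play_measure_def by (rule IT.distr_lim) simp
  also have "(AE x in IT.CI {0..<n}. Q (map x [0..<n])) \<longleftrightarrow>
      (AE x in IT.C 0 n (\<lambda>_. undefined). Q (map x [0..<n]))"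
    unfolding IT.CI_def up
    using Q measurable_cong_sets[OF IT.sets_C[OF u, of n] refl]
    by (subst AE_distr_iff) (auto simp only: restr add_0 intro!: measurable_restrict_subset)
  also have "\<dots> \<longleftrightarrow> (\<forall>h. plausible P \<sigma> v h \<longrightarrow> length h = n \<longrightarrow> Q h)"
    by (rule AE_prefix_kernel_iff)
  finally show ?thesis .
qed

lemma Safety_measurable: "Safety T \<in> sets (play_measure P \<sigma> v)"
proof -
  have "(\<lambda>\<omega>. \<omega> i) \<in> PiM UNIV (\<lambda>_. count_space UNIV) \<rightarrow>\<^sub>M (count_space UNIV :: 'v measure)" for i :: nat
    by measurable
  then have "{\<omega> \<in> space (PiM UNIV (\<lambda>_. count_space (UNIV :: 'v set))). \<forall>i::nat. \<omega> i \<notin> T} \<in>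
      sets (PiM UNIV (\<lambda>_. count_space UNIV))"
    by measurable
  then show ?thesis
    by (simp add: sets_play_measure Safety_def space_PiM)
qed

lemma disj_Safety_measurable: "(\<Union>T\<in>set Ts. Safety T) \<in> sets (play_measure P \<sigma> v)"
  by (intro sets.finite_UN) (auto intro: Safety_measurable)

text \<open>Safety is a countable intersection of conditions on finite prefixes, and countably many
  almost-sure events hold jointly.\<close>

lemma measure_Safety_eq_1:
  assumes "\<And>h. plausible P \<sigma> v h \<Longrightarrow> set h \<inter> T = {}"
  shows "measure (play_measure P \<sigma> v) (Safety T) = 1"
proof -
  interpret prob_space "play_measure P \<sigma> v" by (rule prob_space_play_measure)
  have "AE \<omega> in play_measure P \<sigma> v. set (map \<omega> [0..<n]) \<inter> T = {}" for n
    using assms by (subst AE_play_prefix_iff) blast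
  then have "AE \<omega> in play_measure P \<sigma> v. \<forall>n. set (map \<omega> [0..<n]) \<inter> T = {}"
    by (subst AE_all_countable) blast
  then have "AE \<omega> in play_measure P \<sigma> v. \<omega> \<in> Safety T"
  proof eventually_elim
    case (elim \<omega>)
    have "\<omega> i \<notin> T" for i using elim[rule_format, of "Suc i"] by auto
    then show ?case by (simp add: Safety_def)
  qed
  then show ?thesis
    by (subst prob_eq_1) (auto simp: Safety_measurable)
qed

text \<open>Used contrapositively: a single history of positive probability that meets every target
  set refutes winning with probability 1.\<close>

lemma plausible_avoids_some_target:
  assumes 1: "measure (play_measure P \<sigma> v) (\<Union>T\<in>set Ts. Safety T) = 1"
    and h: "plausible P \<sigma> v h"
  shows "\<exists>T\<in>set Ts. set h \<inter> T = {}"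
proof -
  interpret prob_space "play_measure P \<sigma> v" by (rule prob_space_play_measure)
  have "AE \<omega> in play_measure P \<sigma> v. \<omega> \<in> (\<Union>T\<in>set Ts. Safety T)"
    using 1 by (simp only: prob_eq_1 disj_Safety_measurable)
  then have "AE \<omega> in play_measure P \<sigma> v. \<exists>T\<in>set Ts. set (map \<omega> [0..<length h]) \<inter> T = {}"
    by eventually_elim (auto simp: Safety_def)
  then show ?thesis
    using h by (subst (asm) AE_play_prefix_iff) blast
qed

end

text \<open>A strategy that is safe for one target set also wins the union, by monotonicity of the
  measure.\<close>

lemma disj_query_win_subset: "disj_query_win P Ts \<subseteq> disj_objective_win P Ts"
proof
  fix v assume "v \<in> disj_query_win P Ts"
  then obtain T \<sigma> where T: "T \<in> set Ts" and v: "v \<in> verts P" and \<sigma>: "is_strategy P \<sigma>"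
    and 1: "measure (play_measure P \<sigma> v) (Safety T) = 1"
    by (auto simp: disj_query_win_def almost_sure_win_def)
  interpret prob_space "play_measure P \<sigma> v" by (rule prob_space_play_measure)
  have "measure (play_measure P \<sigma> v) (Safety T) \<le>
      measure (play_measure P \<sigma> v) (\<Union>T\<in>set Ts. Safety T)"
    using T by (intro finite_measure_mono disj_Safety_measurable) auto
  with 1 have "measure (play_measure P \<sigma> v) (\<Union>T\<in>set Ts. Safety T) = 1"
    by (intro antisym prob_le_1) simp
  with v \<sigma> show "v \<in> disj_objective_win P Ts"
    by (auto simp: disj_objective_win_def almost_sure_win_def)
qed

section \<open>The reduction\<close>

text \<open>Vertex \<open>0\<close> is the start and \<open>1 + 3 * d\<close> lies in every target set. Coordinate \<open>i\<close> has the vertices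
  \<open>2 + 3 * i\<close> (visited from the vectors in \<open>us\<close> whose \<open>i\<close>-th entry is 1), \<open>3 + 3 * i\<close> (visited when it is 0,
  in no target set) and \<open>1 + 3 * i\<close> (never visited from \<open>0\<close>). The last two pad out-degrees and target
  sets to \<open>d + 1\<close>, so that no counting is needed to write the instance. Vertex \<open>2 + 3 * d + j\<close>
  is the random vertex of \<open>us ! j\<close>.\<close>

definition ov_succs :: "nat \<Rightarrow> nat list list \<Rightarrow> nat \<Rightarrow> nat set" where
  "ov_succs d us u =
     (if u = 0 then {1 + 3 * d..<2 + 3 * d + length us}
      else if u < 2 + 3 * d then {0}
      else insert 0 ((\<lambda>i. 3 + 3 * i - us ! (u - (2 + 3 * d)) ! i) ` {..<d}))"

text \<open>The successor \<open>1 + 3 * d\<close> of the start keeps it from being a dead end when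
  \<open>us\<close> is empty; lying in every target set, it never helps player 1. Coordinate
  vertices belong to player 1, so that the random vertices are exactly the vector vertices and all
  probabilities equal \<open>1 / Suc d\<close>.\<close>

definition ov_mdp :: "nat \<Rightarrow> nat list list \<Rightarrow> nat mdp" where
  "ov_mdp d us =
     \<lparr>verts = {..<2 + 3 * d + length us},
      edges = (SIGMA u:{..<2 + 3 * d + length us}. ov_succs d us u),
      player1 = {..<2 + 3 * d},
      random = {2 + 3 * d..<2 + 3 * d + length us},
      delta = (\<lambda>u. pmf_of_set (ov_succs d us u))\<rparr>"

definition ov_target_list :: "nat \<Rightarrow> nat list \<Rightarrow> nat list" where
  "ov_target_list d v = (1 + 3 * d) # map (\<lambda>i. 1 + 3 * i + v ! i) [0..<d]"

text \<open>The edge to \<open>0\<close> gives every vector vertex a direct return to the start with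
  positive probability, whatever the entries of its vector are.\<close>

definition ov_vector_edges :: "nat \<Rightarrow> nat list list \<Rightarrow> nat \<Rightarrow> (nat \<times> nat \<times> nat \<times> nat) list" where
  "ov_vector_edges d us j =
     (2 + 3 * d + j, 0, 1, Suc d) #
     map (\<lambda>i. (2 + 3 * d + j, 3 + 3 * i - us ! j ! i, 1, Suc d)) [0..<d]"

definition ov_edges :: "nat \<Rightarrow> nat list list \<Rightarrow> (nat \<times> nat \<times> nat \<times> nat) list" where
  "ov_edges d us =
     map (\<lambda>j. (0, 1 + 3 * d + j, 0, 0)) [0..<Suc (length us)] @
     map (\<lambda>i. (Suc i, 0, 0, 0)) [0..<Suc (3 * d)] @
     concat (map (ov_vector_edges d us) [0..<length us])"

definition ov_instance :: "nat \<Rightarrow> nat list list \<Rightarrow> nat list list \<Rightarrow> nat list" where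
  "ov_instance d us vs =
     [2 + 3 * d + length us, length (ov_edges d us), length vs] @
     replicate (2 + 3 * d) 1 @ replicate (length us) 0 @
     concat (map (\<lambda>(u, v, a, b). [u, v, a, b]) (ov_edges d us)) @
     concat (map (\<lambda>v. Suc d # ov_target_list d v) vs)"

definition bit_vector :: "nat \<Rightarrow> nat list \<Rightarrow> bool" where
  "bit_vector d u \<longleftrightarrow> length u = d \<and> set u \<subseteq> {0, 1}"

section \<open>Well-formedness and encoding of the constructed instance\<close>

lemma bit_vector_nth_le: "bit_vector d u \<Longrightarrow> i < d \<Longrightarrow> u ! i \<le> 1"
  unfolding bit_vector_def using nth_mem[of i u] by fastforce

lemma bit_vector_nth_cases: "bit_vector d u \<Longrightarrow> i < d \<Longrightarrow> u ! i = 0 \<or> u ! i = 1"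
  using bit_vector_nth_le[of d u i] by auto

lemma length_ov_edges:
  "length (ov_edges d us) = length us * (d + 2) + 3 * d + 2"
  by (simp add: ov_edges_def ov_vector_edges_def length_concat comp_def sum_list_triv algebra_simps)

lemma finite_ov_succs: "finite (ov_succs d us u)"
  by (simp add: ov_succs_def)

lemma ov_succs_nonempty: "ov_succs d us u \<noteq> {}"
  by (simp add: ov_succs_def)

lemma ov_succs_vector:
  "ov_succs d us (2 + 3 * d + j) = insert 0 ((\<lambda>i. 3 + 3 * i - us ! j ! i) ` {..<d})"
  by (simp add: ov_succs_def)

text \<open>Index \<open>i\<close> yields a vertex in the block
  \<open>{2 + 3 * i, 3 + 3 * i}\<close>, and these blocks are disjoint.\<close>

lemma inj_on_coordinate_vertices:
  assumes "bit_vector d u"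
  shows "inj_on (\<lambda>i. 3 + 3 * i - u ! i) {..<d}"
proof (rule inj_onI)
  fix i k assume "i \<in> {..<d}" "k \<in> {..<d}" "3 + 3 * i - u ! i = 3 + 3 * k - u ! k"
  then show "i = k"
    using bit_vector_nth_le[OF assms, of i] bit_vector_nth_le[OF assms, of k] by auto
qed

text \<open>The out-degree does not depend on the number of ones, which is what the padding vertices
  are for. Hence the uniform distribution matches the fixed quotient \<open>1 / Suc d\<close> in the
  edge list.\<close>

lemma card_ov_succs_vector:
  assumes "bit_vector d (us ! j)"
  shows "card (ov_succs d us (2 + 3 * d + j)) = Suc d"
proof -
  have "0 \<notin> (\<lambda>i. 3 + 3 * i - us ! j ! i) ` {..<d}"
  proof
    assume "0 \<in> (\<lambda>i. 3 + 3 * i - us ! j ! i) ` {..<d}"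
    then obtain i where "i < d" "3 + 3 * i - us ! j ! i = 0" by auto
    then show False using bit_vector_nth_le[OF assms, of i] by simp
  qed
  then show ?thesis
    using inj_on_coordinate_vertices[OF assms] unfolding ov_succs_vector by (simp add: card_image)
qed

lemma ov_succs_subset:
  assumes "\<forall>u\<in>set us. bit_vector d u" "u < 2 + 3 * d + length us"
  shows "ov_succs d us u \<subseteq> {..<2 + 3 * d + length us}"
  using assms by (auto simp: ov_succs_def)

lemma is_mdp_ov_mdp:
  assumes "\<forall>u\<in>set us. bit_vector d u"
  shows "is_mdp (ov_mdp d us)"
  unfolding is_mdp_def
proof (intro conjI ballI)
  show "edges (ov_mdp d us) \<subseteq> verts (ov_mdp d us) \<times> verts (ov_mdp d us)"
    using ov_succs_subset[OF assms] by (auto simp: ov_mdp_def)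
  show "\<exists>v. (u, v) \<in> edges (ov_mdp d us)" if "u \<in> verts (ov_mdp d us)" for u
    using that ov_succs_nonempty[of d us u] by (auto simp: ov_mdp_def)
  show "set_pmf (delta (ov_mdp d us) u) = {v. (u, v) \<in> edges (ov_mdp d us)}"
    if "u \<in> random (ov_mdp d us)" for u
    using that by (auto simp: ov_mdp_def set_pmf_of_set finite_ov_succs ov_succs_nonempty)
qed (auto simp: ov_mdp_def)

lemma set_ov_edges:
  "(\<lambda>(u, v, a, b). (u, v)) ` set (ov_edges d us) = edges (ov_mdp d us)"
proof -
  let ?n = "2 + 3 * d + length us"
  \<comment> \<open>The edges are split by source: the start, the vertices whose only successor is
    the start, and the vector vertices.\<close>
  have "(\<lambda>(u, v, a, b). (u, v)) ` set (ov_edges d us) =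
      {0} \<times> {1 + 3 * d..<?n} \<union> {1..<2 + 3 * d} \<times> {0} \<union>
      (SIGMA u:{2 + 3 * d..<?n}. ov_succs d us u)" (is "?L = ?A \<union> ?B \<union> ?C")
  proof -
    have "(\<lambda>(u, v, a, b). (u, v)) ` set (map (\<lambda>j. (0::nat, 1 + 3 * d + j, 0::nat, 0::nat)) [0..<Suc (length us)]) = ?A"
    proof -
      have "{1 + 3 * d..<?n} = (+) (1 + 3 * d) ` {0..<Suc (length us)}"
        by (simp only: image_add_atLeastLessThan) (simp add: algebra_simps)
      then show ?thesis by (simp only: set_map set_upt image_image) auto
    qed
    moreover have "(\<lambda>(u, v, a, b). (u, v)) ` set (map (\<lambda>i. (Suc i, 0::nat, 0::nat, 0::nat)) [0..<Suc (3 * d)]) = ?B"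
    proof -
      have *: "{1..<2 + 3 * d} = Suc ` {0..<Suc (3 * d)}"
        by (simp only: image_Suc_atLeastLessThan) simp
      show ?thesis unfolding * by (auto simp: image_image simp del: image_Suc_atLeastLessThan upt_Suc)
    qed
    moreover have "(\<lambda>(u, v, a, b). (u, v)) ` set (concat (map (ov_vector_edges d us) [0..<length us])) = ?C"
    proof -
      have *: "(\<lambda>(u, v, a, b). (u, v)) ` set (ov_vector_edges d us j) =
          {2 + 3 * d + j} \<times> ov_succs d us (2 + 3 * d + j)" for j
        unfolding ov_succs_vector ov_vector_edges_def
        by (auto simp: image_image)
      have "{2 + 3 * d..<?n} = (+) (2 + 3 * d) ` {0..<length us}"
        by (simp only: image_add_atLeastLessThan) (simp add: algebra_simps)
      then show ?thesis
        by (simp only: set_concat set_map set_upt image_UN image_image *) auto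
    qed
    ultimately show ?thesis
      by (simp only: ov_edges_def set_append image_Un Un_assoc)
  qed
  also have "\<dots> = edges (ov_mdp d us)"
    by (auto simp: ov_mdp_def ov_succs_def split: if_splits)
  finally show ?thesis .
qed

text \<open>Out-degrees are summed over the three classes of sources. The result gives the parameter
  \<open>m\<close> of the instance; together with \<open>set_ov_edges\<close> it also shows that the
  edge list has no repetitions.\<close>

lemma card_ov_mdp_edges:
  assumes "\<forall>u\<in>set us. bit_vector d u"
  shows "card (edges (ov_mdp d us)) = length (ov_edges d us)"
proof -
  let ?n = "2 + 3 * d + length us"
  have "card (edges (ov_mdp d us)) = (\<Sum>u<?n. card (ov_succs d us u))"
    by (simp add: ov_mdp_def card_SigmaI finite_ov_succs)
  also have "{..<?n} = {0} \<union> {1..<2 + 3 * d} \<union> (+) (2 + 3 * d) ` {0..<length us}"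
    by (simp only: image_add_atLeastLessThan) auto
  also have "(\<Sum>u\<in>\<dots>. card (ov_succs d us u)) =
      (\<Sum>u\<in>{0}. card (ov_succs d us u)) + (\<Sum>u\<in>{1..<2 + 3 * d}. card (ov_succs d us u)) +
      (\<Sum>u\<in>(+) (2 + 3 * d) ` {0..<length us}. card (ov_succs d us u))"
    by (subst sum.union_disjoint; (subst sum.union_disjoint)?) auto
  also have "(\<Sum>u\<in>{0}. card (ov_succs d us u)) = Suc (length us)"
    by (simp add: ov_succs_def)
  also have "(\<Sum>u\<in>{1..<2 + 3 * d}. card (ov_succs d us u)) = (\<Sum>u\<in>{1..<2 + 3 * d}. 1)"
    by (intro sum.cong) (auto simp: ov_succs_def)
  also have "(\<Sum>u\<in>(+) (2 + 3 * d) ` {0..<length us}. card (ov_succs d us u)) =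
      (\<Sum>j\<in>{0..<length us}. card (ov_succs d us (2 + 3 * d + j)))"
    by (subst sum.reindex) auto
  also have "\<dots> = (\<Sum>j\<in>{0..<length us}. Suc d)"
    using assms by (intro sum.cong refl card_ov_succs_vector) auto
  finally show ?thesis
    by (simp add: length_ov_edges algebra_simps)
qed

lemma set_ov_target_list:
  "set (ov_target_list d v) = insert (1 + 3 * d) ((\<lambda>i. 1 + 3 * i + v ! i) ` {..<d})"
  by (simp add: ov_target_list_def atLeast0LessThan)

lemma map_threshold_upt:
  "map (\<lambda>u. if u < k then 1 else 0) [0..<k + n] = replicate k (1::nat) @ replicate n 0"
  by (rule nth_equalityI) (auto simp: nth_append)

lemma encodes_ov_instance:
  assumes us: "\<forall>u\<in>set us. bit_vector d u" and vs: "\<forall>v\<in>set vs. bit_vector d v"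
  shows "encodes_instance (ov_mdp d us) (map (\<lambda>v. set (ov_target_list d v)) vs) (ov_instance d us vs)"
proof -
  let ?P = "ov_mdp d us" and ?n = "2 + 3 * d + length us"
  have sub: "set (ov_target_list d v) \<subseteq> verts ?P" if "v \<in> set vs" for v
  proof
    fix w assume "w \<in> set (ov_target_list d v)"
    then consider "w = 1 + 3 * d" | i where "i < d" "w = 1 + 3 * i + v ! i"
      by (auto simp: set_ov_target_list)
    then show "w \<in> verts ?P"
    proof cases
      case (2 i)
      then show ?thesis
        using that vs bit_vector_nth_le[of d v i] by (simp add: ov_mdp_def)
    qed (simp add: ov_mdp_def)
  qed
  have dist: "distinct (ov_target_list d v)" if "v \<in> set vs" for v
  proof -
    have le: "v ! i \<le> 1" if "i < d" for i
      using bit_vector_nth_le[of d v i] vs that \<open>v \<in> set vs\<close> by auto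
    have "1 + 3 * d \<notin> set (map (\<lambda>i. 1 + 3 * i + v ! i) [0..<d])"
    proof
      assume "1 + 3 * d \<in> set (map (\<lambda>i. 1 + 3 * i + v ! i) [0..<d])"
      then obtain i where "i < d" "1 + 3 * d = 1 + 3 * i + v ! i" by auto
      then show False using le[of i] by linarith
    qed
    moreover have "inj_on (\<lambda>i. 1 + 3 * i + v ! i) {0..<d}"
    proof (rule inj_onI)
      fix i k assume "i \<in> {0..<d}" "k \<in> {0..<d}" "1 + 3 * i + v ! i = 1 + 3 * k + v ! k"
      then show "i = k" using le[of i] le[of k] by auto
    qed
    ultimately show ?thesis
      by (simp add: ov_target_list_def distinct_map)
  qed
  have probs: "if u \<in> random ?P then b \<noteq> 0 \<and> pmf (delta ?P u) v = real a / real b else a = 0 \<and> b = 0"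
    if e: "(u, v, a, b) \<in> set (ov_edges d us)" for u v a b
  proof -
    consider "u < 2 + 3 * d" "a = 0" "b = 0"
      | j where "j < length us" "(u, v, a, b) \<in> set (ov_vector_edges d us j)"
      using e by (auto simp: ov_edges_def)
    then show ?thesis
    proof cases
      case (2 j)
      then have u: "u = 2 + 3 * d + j" by (auto simp: ov_vector_edges_def)
      with 2 have "v \<in> ov_succs d us u" and "a = 1" "b = Suc d"
        unfolding u ov_succs_vector by (auto simp: ov_vector_edges_def)
      with 2 u us card_ov_succs_vector[of d us j] show ?thesis
        by (simp add: ov_mdp_def finite_ov_succs ov_succs_nonempty)
    qed (auto simp: ov_mdp_def)
  qed
  have D: "distinct (map (\<lambda>(u, v, a, b). (u, v)) (ov_edges d us))"
    by (rule card_distinct) (simp add: set_ov_edges card_ov_mdp_edges[OF us])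
  have L: "list_all2 (\<lambda>T t. distinct t \<and> set t = T)
      (map (\<lambda>v. set (ov_target_list d v)) vs) (map (ov_target_list d) vs)"
    using dist by (auto simp: list_all2_conv_all_nth)
  have B: "map (\<lambda>u. if u \<in> player1 ?P then 1 else 0) [0..<?n] =
      replicate (2 + 3 * d) (1::nat) @ replicate (length us) 0"
    using map_threshold_upt[of "2 + 3 * d" "length us"] unfolding ov_mdp_def
    by (simp only: mdp.simps lessThan_iff)
  have C: "concat (map (\<lambda>v. Suc d # ov_target_list d v) vs) =
      concat (map (\<lambda>t. length t # t) (map (ov_target_list d) vs))"
    by (simp add: comp_def ov_target_list_def)
  show ?thesis
    unfolding encodes_instance_def
  proof (intro conjI exI[of _ ?n] exI[of _ "ov_edges d us"] exI[of _ "map (ov_target_list d) vs"])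
    show "is_mdp ?P" by (rule is_mdp_ov_mdp[OF us])
    show "\<forall>T\<in>set (map (\<lambda>v. set (ov_target_list d v)) vs). T \<subseteq> verts ?P"
      using sub by auto
    show "verts ?P = {..<?n}" by (simp add: ov_mdp_def)
    show "edges ?P = (\<lambda>(u, v, a, b). (u, v)) ` set (ov_edges d us)"
      by (simp only: set_ov_edges)
    show "\<forall>(u, v, a, b)\<in>set (ov_edges d us).
        if u \<in> random ?P then b \<noteq> 0 \<and> pmf (delta ?P u) v = real a / real b else a = 0 \<and> b = 0"
      using probs by blast
  qed (fact D L | simp only: ov_instance_def B C append_assoc length_map)+
qed

section \<open>Correctness of the reduction\<close>

text \<open>Modulo 3 the left side is 0 or 2 and the right side is 1 or 2, so equality forces the
  residue 2, which occurs only when both bits are 1.\<close>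

lemma coordinate_vertex_in_target:
  fixes a b i k :: nat
  assumes "3 + 3 * i - a = 1 + 3 * k + b" "a \<le> 1" "b \<le> 1"
  shows "i = k \<and> a = 1 \<and> b = 1"
proof -
  have "a = 0 \<or> a = 1" "b = 0 \<or> b = 1" using assms(2,3) by auto
  then show ?thesis using assms(1) by (elim disjE) (simp; presburger)+
qed

text \<open>Always picking the same vector \<open>us ! j\<close> of an orthogonal pair confines the
  play to the set \<open>?I\<close>, which is disjoint from the target set of
  \<open>v\<close>.\<close>

lemma orthogonal_imp_in_disj_query_win:
  assumes us: "\<forall>u\<in>set us. bit_vector d u" and vs: "\<forall>v\<in>set vs. bit_vector d v"
    and orth: "orthogonal_pair d (set us) (set vs)"
  shows "0 \<in> disj_query_win (ov_mdp d us) (map (\<lambda>v. set (ov_target_list d v)) vs)"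
proof -
  let ?P = "ov_mdp d us"
  from orth obtain j v where j: "j < length us" and v: "v \<in> set vs"
    and 0: "(\<Sum>i<d. us ! j ! i * v ! i) = 0"
    unfolding orthogonal_pair_def by (metis in_set_conv_nth)
  have uj: "bit_vector d (us ! j)" using us j by simp
  \<comment> \<open>At a player-1 vertex other than the start, \<open>0\<close> is the only legal
    move.\<close>
  define \<sigma> where "\<sigma> h = (if last h = 0 then 2 + 3 * d + j else 0)" for h :: "nat list"
  let ?I = "insert 0 (insert (2 + 3 * d + j) ((\<lambda>i. 3 + 3 * i - us ! j ! i) ` {..<d}))"
  have strat: "is_strategy ?P \<sigma>"
    using j by (auto simp: is_strategy_def ov_mdp_def \<sigma>_def ov_succs_def)
  have "set h \<subseteq> ?I" if "plausible ?P \<sigma> 0 h" for h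
    using that
  proof induction
    case (snoc h y)
    have "y \<in> ?I"
    proof (cases "h = []")
      case True
      with snoc show ?thesis by (simp add: next_pmf_def)
    next
      case False
      then have "last h \<in> ?I" using snoc last_in_set by blast
      moreover have "3 + 3 * i - us ! j ! i < 2 + 3 * d" if "i < d" for i using that by simp
      \<comment> \<open>The chosen vector vertex is the only random vertex in
        \<open>?I\<close>.\<close>
      ultimately have "last h \<noteq> 2 + 3 * d + j \<Longrightarrow> last h < 2 + 3 * d" by auto
      then show ?thesis
        using snoc(2) False
        by (cases "last h = 2 + 3 * d + j")
          (auto simp: next_pmf_def ov_mdp_def \<sigma>_def set_pmf_of_set finite_ov_succs
             ov_succs_nonempty ov_succs_vector[simplified])
    qed
    with snoc show ?case by simp
  qed simp
  moreover have "?I \<inter> set (ov_target_list d v) = {}"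
  proof -
    have ule: "us ! j ! i \<le> 1" if "i < d" for i
      using that bit_vector_nth_le[OF uj] by simp
    have vle: "v ! i \<le> 1" if "i < d" for i
      using that v vs bit_vector_nth_le[of d v] by simp
    have "3 + 3 * i - us ! j ! i \<noteq> 1 + 3 * k + v ! k" if "i < d" "k < d" for i k
    proof
      assume *: "3 + 3 * i - us ! j ! i = 1 + 3 * k + v ! k"
      \<comment> \<open>A common vertex would be a coordinate at which both vectors have entry 1,
        contradicting the vanishing sum.\<close>
      have "i = k \<and> us ! j ! i = 1 \<and> v ! k = 1"
        using coordinate_vertex_in_target[OF * ule[OF that(1)] vle[OF that(2)]] .
      then show False using 0 that by force
    qed
    moreover have "3 + 3 * i - us ! j ! i \<noteq> 1 + 3 * d" if "i < d" for i
      using ule[OF that] that by auto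
    moreover have "2 + 3 * d + j \<noteq> 1 + 3 * i + v ! i" if "i < d" for i
      using vle[OF that] that by auto
    ultimately show ?thesis
      by (auto simp: set_ov_target_list)
  qed
  ultimately have "measure (play_measure ?P \<sigma> 0) (Safety (set (ov_target_list d v))) = 1"
    by (intro measure_Safety_eq_1) blast
  then show ?thesis
    using strat v by (auto simp: disj_query_win_def almost_sure_win_def ov_mdp_def)
qed

text \<open>At a player-1 vertex other than the start the move to \<open>0\<close> is forced; at a
  vector vertex it is possible through the additional edge.\<close>

lemma plausible_return_to_start:
  assumes strat: "is_strategy (ov_mdp d us) \<sigma>"
    and h: "plausible (ov_mdp d us) \<sigma> w h" "h \<noteq> []" "set h \<subseteq> verts (ov_mdp d us)" "last h \<noteq> 0"
  shows "plausible (ov_mdp d us) \<sigma> w (h @ [0])"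
proof (rule plausible.snoc[OF h(1)])
  show "0 \<in> set_pmf (next_pmf (ov_mdp d us) \<sigma> w h)"
  proof (cases "last h < 2 + 3 * d")
    case True
    then have "(last h, \<sigma> h) \<in> edges (ov_mdp d us)"
      using strat h unfolding is_strategy_def by (auto simp: ov_mdp_def)
    with True h show ?thesis
      by (auto simp: next_pmf_def ov_mdp_def ov_succs_def)
  next
    case False
    with h show ?thesis
      by (auto simp: next_pmf_def ov_mdp_def set_pmf_of_set finite_ov_succs ov_succs_nonempty)
        (simp add: ov_succs_def)
  qed
qed

text \<open>Induction over the target sets: from a history ending in the start, whatever the
  strategy picks next can be continued so that one more set is hit and the play returns. Extending
  one history, rather than combining separate ones, copes with strategies that have memory. The
  initial vertex \<open>w\<close> is arbitrary because the whole winning set has to be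
  empty.\<close>

lemma plausible_hitting_all_targets:
  assumes us: "\<forall>u\<in>set us. bit_vector d u" and vs: "\<forall>v\<in>set vs. bit_vector d v"
    and northo: "\<not> orthogonal_pair d (set us) (set vs)"
    and strat: "is_strategy (ov_mdp d us) \<sigma>"
    and w: "w \<in> verts (ov_mdp d us)"
    and sub: "set vs' \<subseteq> set vs"
  shows "\<exists>h. plausible (ov_mdp d us) \<sigma> w h \<and> h \<noteq> [] \<and> last h = 0 \<and> set h \<subseteq> verts (ov_mdp d us) \<and>
    (\<forall>v\<in>set vs'. set h \<inter> set (ov_target_list d v) \<noteq> {})"
  using sub
proof (induction vs')
  case Nil
  have 0: "plausible (ov_mdp d us) \<sigma> w [w]"
    using plausible.snoc[OF plausible.Nil, of w "ov_mdp d us" \<sigma> w] by (simp add: next_pmf_def)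
  show ?case
  proof (cases "w = 0")
    case True
    with 0 show ?thesis by (intro exI[of _ "[w]"]) (auto simp: ov_mdp_def)
  next
    case False
    have "plausible (ov_mdp d us) \<sigma> w ([w] @ [0])"
      by (rule plausible_return_to_start[OF strat 0]) (use w False in auto)
    with w show ?thesis by (intro exI[of _ "[w] @ [0]"]) (auto simp: ov_mdp_def)
  qed
next
  case (Cons v vs')
  let ?P = "ov_mdp d us"
  from Cons obtain h where h: "plausible ?P \<sigma> w h" "h \<noteq> []" "last h = 0" "set h \<subseteq> verts ?P"
    and hit: "\<forall>v\<in>set vs'. set h \<inter> set (ov_target_list d v) \<noteq> {}"
    by auto
  have v: "v \<in> set vs" using Cons by simp
  let ?x = "\<sigma> h"
  have "(last h, ?x) \<in> edges ?P"
    using strat h unfolding is_strategy_def by (auto simp: ov_mdp_def)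
  then have x: "1 + 3 * d \<le> ?x" "?x < 2 + 3 * d + length us"
    using h(3) by (auto simp: ov_mdp_def ov_succs_def)
  have hx: "plausible ?P \<sigma> w (h @ [?x])"
    by (rule plausible.snoc[OF h(1)]) (use h in \<open>simp add: next_pmf_def ov_mdp_def\<close>)
  have hxv: "set (h @ [?x]) \<subseteq> verts ?P"
    using h x by (auto simp: ov_mdp_def)
  show ?case
  proof (cases "?x = 1 + 3 * d")
    \<comment> \<open>The strategy picked the vertex that belongs to all target sets.\<close>
    case True
    have "plausible ?P \<sigma> w ((h @ [?x]) @ [0])"
      by (rule plausible_return_to_start[OF strat hx _ hxv]) (use x in auto)
    with hit hxv True show ?thesis
      by (intro exI[of _ "(h @ [?x]) @ [0]"]) (auto simp: set_ov_target_list ov_mdp_def)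
  next
    case False
    define j where "j = ?x - (2 + 3 * d)"
    have j: "?x = 2 + 3 * d + j" "j < length us" using x False by (auto simp: j_def)
    have uj: "bit_vector d (us ! j)" using us j by simp
    have vb: "bit_vector d v" using vs v by simp
    \<comment> \<open>The picked vector and \<open>v\<close> share a coordinate with entry 1, and
      the random vertex moves to it with positive probability.\<close>
    have "(\<Sum>i<d. us ! j ! i * v ! i) \<noteq> 0"
      using northo v j unfolding orthogonal_pair_def by auto
    then obtain i where i: "i < d" "us ! j ! i * v ! i \<noteq> 0"
      by (auto simp: sum_eq_0_iff)
    then have ones: "us ! j ! i = 1" "v ! i = 1"
      using bit_vector_nth_cases[OF uj i(1)] bit_vector_nth_cases[OF vb i(1)] by auto
    let ?c = "2 + 3 * i"
    have "?c \<in> ov_succs d us ?x"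
      unfolding j ov_succs_vector using i(1) ones(1) by (auto simp: image_iff intro!: bexI[of _ i])
    then have "plausible ?P \<sigma> w ((h @ [?x]) @ [?c])"
      using x j
      by (intro plausible.snoc[OF hx])
        (auto simp: next_pmf_def ov_mdp_def set_pmf_of_set finite_ov_succs ov_succs_nonempty)
    moreover have cv: "set ((h @ [?x]) @ [?c]) \<subseteq> verts ?P"
      using hxv i(1) by (auto simp: ov_mdp_def)
    ultimately have "plausible ?P \<sigma> w (((h @ [?x]) @ [?c]) @ [0])"
      by (intro plausible_return_to_start[OF strat]) auto
    moreover have "?c \<in> set (ov_target_list d v)"
      using i(1) ones(2) by (auto simp: set_ov_target_list image_iff intro!: bexI[of _ i])
    ultimately show ?thesis
      using hit cv by (intro exI[of _ "((h @ [?x]) @ [?c]) @ [0]"]) (auto simp: ov_mdp_def)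
  qed
qed

lemma not_orthogonal_imp_disj_objective_win_empty:
  assumes us: "\<forall>u\<in>set us. bit_vector d u" and vs: "\<forall>v\<in>set vs. bit_vector d v"
    and northo: "\<not> orthogonal_pair d (set us) (set vs)"
  shows "disj_objective_win (ov_mdp d us) (map (\<lambda>v. set (ov_target_list d v)) vs) = {}"
proof (rule ccontr)
  assume "\<not> ?thesis"
  then obtain w \<sigma> where w: "w \<in> verts (ov_mdp d us)" and strat: "is_strategy (ov_mdp d us) \<sigma>"
    and 1: "measure (play_measure (ov_mdp d us) \<sigma> w)
      (\<Union>T\<in>set (map (\<lambda>v. set (ov_target_list d v)) vs). Safety T) = 1"
    unfolding disj_objective_win_def almost_sure_win_def by blast
  obtain h where h: "plausible (ov_mdp d us) \<sigma> w h"
    and hit: "\<forall>v\<in>set vs. set h \<inter> set (ov_target_list d v) \<noteq> {}"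
    using plausible_hitting_all_targets[OF us vs northo strat w subset_refl] by blast
  show False
    using plausible_avoids_some_target[OF 1 h] hit by auto
qed

text \<open>The query winning set is contained in the objective one. Both are handled at once
  because the smaller contains the start in the orthogonal case and the larger is empty
  otherwise.\<close>

lemma ov_mdp_win:
  assumes us: "\<forall>u\<in>set us. bit_vector d u" and vs: "\<forall>v\<in>set vs. bit_vector d v"
    and win: "win \<in> {disj_objective_win, disj_query_win}"
  defines "W \<equiv> win (ov_mdp d us) (map (\<lambda>v. set (ov_target_list d v)) vs)"
  shows "W \<noteq> {} \<longleftrightarrow> orthogonal_pair d (set us) (set vs)"
    and "0 \<in> W \<longleftrightarrow> orthogonal_pair d (set us) (set vs)"
proof -
  have "0 \<in> W" if "orthogonal_pair d (set us) (set vs)"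
    using orthogonal_imp_in_disj_query_win[OF us vs that] win
      disj_query_win_subset[of "ov_mdp d us"] unfolding W_def by blast
  moreover have "W = {}" if "\<not> orthogonal_pair d (set us) (set vs)"
    using not_orthogonal_imp_disj_objective_win_empty[OF us vs that] win
      disj_query_win_subset[of "ov_mdp d us"] unfolding W_def by blast
  ultimately show "W \<noteq> {} \<longleftrightarrow> orthogonal_pair d (set us) (set vs)"
    and "0 \<in> W \<longleftrightarrow> orthogonal_pair d (set us) (set vs)" by blast+
qed

section \<open>Symbolic execution of word RAM programs\<close>

text \<open>\<open>W\<close> only limits the values that may be computed. This lets an algorithm
  that is correct for the word size of its own input run inside a program with larger words.\<close>

lemma exec_mono_word: "exec W p s t s' \<Longrightarrow> W \<le> W' \<Longrightarrow> exec W' p s t s'"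
  by (induction rule: exec.induct)
    (auto simp del: One_nat_def intro: exec.intros less_le_trans)

text \<open>Total correctness within a time budget, in the style of a weakest precondition, so that
  straight-line code can be evaluated by rewriting.\<close>

definition reaches :: "nat \<Rightarrow> prog \<Rightarrow> ram_state \<Rightarrow> nat \<Rightarrow> (ram_state \<Rightarrow> bool) \<Rightarrow> bool" where
  "reaches W p s T Q \<longleftrightarrow> (\<exists>t s'. exec W p s t s' \<and> t \<le> T \<and> Q s')"

lemma reaches_mono:
  "reaches W p s T Q \<Longrightarrow> T \<le> T' \<Longrightarrow> (\<And>s'. Q s' \<Longrightarrow> Q' s') \<Longrightarrow> reaches W p s T' Q'"
  unfolding reaches_def by (meson le_trans)

lemma reaches_Seq:
  "reaches W p s T (\<lambda>s'. reaches W q s' T' Q) \<Longrightarrow> reaches W (Seq p q) s (T + T') Q"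
  unfolding reaches_def by (meson add_mono exec.Seq)

lemma reaches_SeqI:
  assumes "reaches W p s T P" "\<And>s'. P s' \<Longrightarrow> reaches W q s' T' Q" "T + T' \<le> T''"
  shows "reaches W (Seq p q) s T'' Q"
  by (rule reaches_mono[OF reaches_Seq]) (use assms in \<open>auto intro: reaches_mono\<close>)

inductive_cases exec_ConstE: "exec W (Const r n) s t s'"
inductive_cases exec_OpE: "exec W (Op f r a b) s t s'"
inductive_cases exec_LoadE: "exec W (Load r a) s t s'"
inductive_cases exec_StoreE: "exec W (Store a b) s t s'"
inductive_cases exec_SeqE: "exec W (Seq p q) s t s'"

lemma reaches_Const [simp]:
  "reaches W (Const r n) (R, M) T Q \<longleftrightarrow> n < W \<and> 1 \<le> T \<and> Q (R(r := n), M)"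
  unfolding reaches_def by (fastforce elim!: exec_ConstE intro: exec.Const simp del: One_nat_def)

lemma reaches_Op [simp]:
  "reaches W (Op f r a b) (R, M) T Q \<longleftrightarrow>
     binop_val f (R a) (R b) < W \<and> 1 \<le> T \<and> Q (R(r := binop_val f (R a) (R b)), M)"
  unfolding reaches_def by (fastforce elim!: exec_OpE intro: exec.Op simp del: One_nat_def)

lemma reaches_Load [simp]:
  "reaches W (Load r a) (R, M) T Q \<longleftrightarrow> 1 \<le> T \<and> Q (R(r := M (R a)), M)"
  unfolding reaches_def by (fastforce elim!: exec_LoadE intro: exec.Load simp del: One_nat_def)

lemma reaches_Store [simp]:
  "reaches W (Store a b) (R, M) T Q \<longleftrightarrow> 1 \<le> T \<and> Q (R, M(R a := R b))"
  unfolding reaches_def by (fastforce elim!: exec_StoreE intro: exec.Store simp del: One_nat_def)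

text \<open>Taking for \<open>Q\<close> the equality with the state actually reached shows that
  \<open>p\<close> can only end in \<open>s'\<close> and takes at least one step, so the rest of the
  budget goes to \<open>q\<close>.\<close>

lemma reaches_Seq_atomic:
  assumes "\<And>T Q. reaches W p s T Q \<longleftrightarrow> c \<and> 1 \<le> T \<and> Q s'"
  shows "reaches W (Seq p q) s T Q \<longleftrightarrow> c \<and> 1 \<le> T \<and> reaches W q s' (T - 1) Q"
proof
  assume "reaches W (Seq p q) s T Q"
  then obtain t1 t2 s1 s2 where e: "exec W p s t1 s1" "exec W q s1 t2 s2" "t1 + t2 \<le> T" "Q s2"
    unfolding reaches_def by (auto elim!: exec_SeqE)
  then have "reaches W p s t1 (\<lambda>x. x = s1)" unfolding reaches_def by blast
  with assms have "c" "1 \<le> t1" "s1 = s'" by auto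
  with e show "c \<and> 1 \<le> T \<and> reaches W q s' (T - 1) Q"
    unfolding reaches_def by fastforce
next
  assume *: "c \<and> 1 \<le> T \<and> reaches W q s' (T - 1) Q"
  then have "reaches W p s 1 (\<lambda>x. x = s')" by (simp add: assms)
  with * show "reaches W (Seq p q) s T Q"
    by (intro reaches_SeqI[of W p s 1 "\<lambda>x. x = s'" q "T - 1"]) auto
qed

lemma reaches_Seq_Const [simp]:
  "reaches W (Seq (Const r n) q) (R, M) T Q \<longleftrightarrow>
     n < W \<and> 1 \<le> T \<and> reaches W q (R(r := n), M) (T - 1) Q"
  by (rule reaches_Seq_atomic) simp

lemma reaches_Seq_Op [simp]:
  "reaches W (Seq (Op f r a b) q) (R, M) T Q \<longleftrightarrow>
     binop_val f (R a) (R b) < W \<and> 1 \<le> T \<and> reaches W q (R(r := binop_val f (R a) (R b)), M) (T - 1) Q"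
  by (rule reaches_Seq_atomic) simp

lemma reaches_Seq_Load [simp]:
  "reaches W (Seq (Load r a) q) (R, M) T Q \<longleftrightarrow> 1 \<le> T \<and> reaches W q (R(r := M (R a)), M) (T - 1) Q"
  using reaches_Seq_atomic[of W "Load r a" "(R, M)" True] by simp

lemma reaches_Seq_Store [simp]:
  "reaches W (Seq (Store a b) q) (R, M) T Q \<longleftrightarrow> 1 \<le> T \<and> reaches W q (R, M(R a := R b)) (T - 1) Q"
  using reaches_Seq_atomic[of W "Store a b" "(R, M)" True] by simp

text \<open>Macros such as \<open>emit\<close> are sequences themselves; reassociation exposes the
  next atomic instruction to the rewrite rules.\<close>

lemma reaches_Seq_assoc [simp]:
  "reaches W (Seq (Seq p q) r) s T Q \<longleftrightarrow> reaches W (Seq p (Seq q r)) s T Q"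
proof -
  have "exec W (Seq (Seq p q) r) s t s' \<longleftrightarrow> exec W (Seq p (Seq q r)) s t s'" for t s'
  proof
    assume "exec W (Seq (Seq p q) r) s t s'"
    then show "exec W (Seq p (Seq q r)) s t s'"
      by (auto elim!: exec_SeqE) (metis exec.Seq add.assoc)
  next
    assume "exec W (Seq p (Seq q r)) s t s'"
    then show "exec W (Seq (Seq p q) r) s t s'"
      by (auto elim!: exec_SeqE) (metis exec.Seq add.assoc)
  qed
  then show ?thesis by (simp add: reaches_def)
qed

text \<open>The invariant is indexed by the number of completed rounds. Each of the \<open>n\<close>
  rounds costs \<open>T\<close> for the body and 1 for the test; the last \<open>+ 1\<close> is the
  failing test.\<close>

lemma reaches_While:
  assumes "\<And>k s. k < n \<Longrightarrow> I k s \<Longrightarrow> fst s r \<noteq> 0 \<and> reaches W p s T (I (Suc k))"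
    and "\<And>s. I n s \<Longrightarrow> fst s r = 0"
    and "I 0 s"
  shows "reaches W (While r p) s (n * (T + 1) + 1) (I n)"
proof -
  have "reaches W (While r p) s ((n - k) * (T + 1) + 1) (I n)" if "k \<le> n" "I k s" for k s
    using that
  proof (induction arbitrary: s rule: inc_induct)
    case base
    have "exec W (While r p) s 1 s"
      by (rule exec.WhileFalse) (rule assms(2)[OF base])
    with base show ?case
      unfolding reaches_def by (intro exI[of _ 1] exI[of _ s]) simp
  next
    case (step k)
    from assms(1)[OF step(2) step(4)] obtain t s1
      where s1: "fst s r \<noteq> 0" "exec W p s t s1" "t \<le> T" "I (Suc k) s1"
      unfolding reaches_def by blast
    from step(3)[OF s1(4)] obtain t' s2
      where s2: "exec W (While r p) s1 t' s2" "t' \<le> (n - Suc k) * (T + 1) + 1" "I n s2"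
      unfolding reaches_def by blast
    have "n - k = Suc (n - Suc k)" using step(2) by simp
    then have "Suc (t + t') \<le> (n - k) * (T + 1) + 1" using s1(3) s2(2) by simp
    with exec.WhileTrue[OF s1(1,2) s2(1)] s2(3) show ?case
      unfolding reaches_def by blast
  qed
  from this[of 0] assms(3) show ?thesis by simp
qed

text \<open>Throughout, register 1 holds 0 and register 2 holds 1; register 0 is the write pointer.\<close>

definition emit :: "nat \<Rightarrow> prog" where
  "emit a = Seq (Store 0 a) (Op Plus 0 0 2)"

definition decr :: "nat \<Rightarrow> prog" where
  "decr r = Op Minus r r 2"

definition incr :: "nat \<Rightarrow> prog" where
  "incr r = Op Plus r r 2"

definition move :: "nat \<Rightarrow> nat \<Rightarrow> prog" where
  "move r a = Op Plus r a 1"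

text \<open>The clause for singletons avoids a trailing \<open>Skip\<close>, which would cost a
  step.\<close>

fun seqs :: "prog list \<Rightarrow> prog" where
  "seqs [] = Skip"
| "seqs [p] = p"
| "seqs (p # ps) = Seq p (seqs ps)"

lemmas macro_defs = emit_def decr_def incr_def move_def

text \<open>The instance is written from address 0 on, while the input is kept in a copy at address \<open>D\<close>.\<close>

definition mem_inv :: "nat list \<Rightarrow> nat \<Rightarrow> nat list \<Rightarrow> (nat \<Rightarrow> nat) \<Rightarrow> bool" where
  "mem_inv xs D out M \<longleftrightarrow>
     (\<forall>i<length out. M i = out ! i) \<and>
     (\<forall>i<length xs. M (D + i) = xs ! i) \<and> (\<forall>i\<ge>D + length xs. M i = 0)"

text \<open>The write lands below \<open>D\<close>, hence neither in the copy of the input nor in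
  the zeros behind it.\<close>

lemma mem_inv_snoc:
  assumes "mem_inv xs D out M" "length out < D"
  shows "mem_inv xs D (out @ [a]) (M(length out := a))"
  using assms by (auto simp: mem_inv_def nth_append less_Suc_eq)

lemma mem_inv_snoc4:
  assumes "mem_inv xs D out M" "length out + 4 \<le> D"
  shows "mem_inv xs D (out @ [a, b, c, e])
    (M(length out := a, Suc (length out) := b, Suc (Suc (length out)) := c,
       Suc (Suc (Suc (length out))) := e))"
proof -
  have "mem_inv xs D (((out @ [a]) @ [b]) @ [c]) (M(length out := a, length (out @ [a]) := b,
      length ((out @ [a]) @ [b]) := c))"
    using assms by (intro mem_inv_snoc) auto
  from mem_inv_snoc[OF this, of e] assms(2) show ?thesis by simp
qed

lemma mem_inv_snoc2:
  assumes "mem_inv xs D out M" "length out + 2 \<le> D"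
  shows "mem_inv xs D (out @ [a, b]) (M(length out := a, Suc (length out) := b))"
proof -
  have "mem_inv xs D ((out @ [a]) @ [b]) (M(length out := a, length (out @ [a]) := b))"
    using assms by (intro mem_inv_snoc) auto
  then show ?thesis by simp
qed

text \<open>Registers 8 to 13 stay free: in the loops 8 points into the copied input, 9 and 10 count
  inner and outer rounds, 11 and 12 hold vertex numbers, and 13 holds the entry just read.\<close>

definition regs :: "nat \<Rightarrow> nat \<Rightarrow> nat \<Rightarrow> nat list \<Rightarrow> nat \<Rightarrow> (nat \<Rightarrow> nat) \<Rightarrow> bool" where
  "regs d n1 n2 xs D R \<longleftrightarrow>
     R 1 = 0 \<and> R 2 = 1 \<and> R 3 = d \<and> R 4 = n1 \<and> R 5 = n2 \<and> R 6 = D \<and> R 7 = length xs \<and>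
     R 14 = d + 1 \<and> R 15 = 3 \<and> R 16 = 3 * d + 1 \<and> (\<forall>r\<ge>17. R r = 0)"

definition ready :: "nat \<Rightarrow> nat \<Rightarrow> nat \<Rightarrow> nat list \<Rightarrow> nat \<Rightarrow> nat list \<Rightarrow> ram_state \<Rightarrow> bool" where
  "ready d n1 n2 xs D out s \<longleftrightarrow>
     fst s 0 = length out \<and> regs d n1 n2 xs D (fst s) \<and> mem_inv xs D out (snd s)"

definition quad :: "nat \<times> nat \<times> nat \<times> nat \<Rightarrow> nat list" where
  "quad = (\<lambda>(u, v, a, b). [u, v, a, b])"

section \<open>The loops that write the instance\<close>

definition fill_loop :: "nat \<Rightarrow> prog" where
  "fill_loop a = While 9 (seqs [emit a, decr 9])"

text \<open>\<open>a\<close> is a register, \<open>x\<close> the constant it holds. As in the other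
  loops, the invariant describes the output after \<open>k\<close> rounds by \<open>ok k\<close>,
  and the bound on \<open>length out\<close> keeps all writes below the copy of the input.\<close>

lemma fill_loop:
  assumes "ready d n1 n2 xs D out s" "fst s 9 = n" "length out + n \<le> D" "D < W"
    and a: "a = 1 \<and> x = 0 \<or> a = 2 \<and> x = 1"
  shows "reaches W (fill_loop a) s (n * 4 + 1) (ready d n1 n2 xs D (out @ replicate n x))"
proof -
  define ok where "ok k = out @ replicate k x" for k
  have ok_Suc: "ok (Suc k) = ok k @ [x]" for k
    by (simp add: ok_def replicate_append_same)
  have len: "length (ok k) = length out + k" for k
    by (simp add: ok_def)
  let ?I = "\<lambda>k s. ready d n1 n2 xs D (ok k) s \<and> fst s 9 = n - k"
  have "reaches W (fill_loop a) s (n * (3 + 1) + 1) (?I n)"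
    unfolding fill_loop_def
  proof (rule reaches_While[where I="?I"])
    fix k s assume "k < n" "?I k s"
    moreover obtain R M where "s = (R, M)" by (cases s)
    ultimately show "fst s 9 \<noteq> 0 \<and> reaches W (seqs [emit a, decr 9]) s 3 (?I (Suc k))"
      using assms(3,4) a mem_inv_snoc[of xs D "ok k" M x]
      by (auto simp: ready_def regs_def macro_defs ok_Suc len)
  qed (use assms in \<open>auto simp: ok_def\<close>)
  then show ?thesis by (rule reaches_mono) (auto simp: ok_def)
qed

definition start_edges_loop :: prog where
  "start_edges_loop = While 9 (seqs [emit 1, emit 11, emit 1, emit 1, incr 11, decr 9])"

lemma start_edges_loop:
  assumes "ready d n1 n2 xs D out s" "fst s 9 = n" "fst s 11 = 1 + 3 * d"
    "length out + 4 * n \<le> D" "D + 1 + 3 * d + n < W"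
  shows "reaches W start_edges_loop s (n * 11 + 1)
    (ready d n1 n2 xs D (out @ concat (map quad (map (\<lambda>i. (0, 1 + 3 * d + i, 0, 0)) [0..<n]))))"
proof -
  define ok where "ok k = out @ concat (map quad (map (\<lambda>i. (0, 1 + 3 * d + i, 0, 0)) [0..<k]))" for k
  have ok_Suc: "ok (Suc k) = ok k @ [0, 1 + 3 * d + k, 0, 0]" for k
    by (simp add: ok_def quad_def)
  have len: "length (ok k) = length out + 4 * k" for k
    by (induction k) (simp_all add: ok_Suc, simp add: ok_def)
  let ?I = "\<lambda>k s. ready d n1 n2 xs D (ok k) s \<and> fst s 11 = 1 + 3 * d + k \<and> fst s 9 = n - k"
  have "reaches W start_edges_loop s (n * (10 + 1) + 1) (?I n)"
    unfolding start_edges_loop_def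
  proof (rule reaches_While[where I="?I"])
    fix k s assume "k < n" "?I k s"
    moreover obtain R M where "s = (R, M)" by (cases s)
    ultimately show "fst s 9 \<noteq> 0 \<and>
        reaches W (seqs [emit 1, emit 11, emit 1, emit 1, incr 11, decr 9]) s 10 (?I (Suc k))"
      using assms(4,5) mem_inv_snoc4[of xs D "ok k" M 0 "1 + 3 * d + k" 0 0]
      by (auto simp: ready_def regs_def macro_defs ok_Suc len)
  qed (use assms in \<open>auto simp: ok_def\<close>)
  then show ?thesis by (rule reaches_mono) (auto simp: ok_def)
qed

definition return_edges_loop :: prog where
  "return_edges_loop = While 9 (seqs [emit 11, emit 1, emit 1, emit 1, incr 11, decr 9])"

lemma return_edges_loop:
  assumes "ready d n1 n2 xs D out s" "fst s 9 = n" "fst s 11 = 1"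
    "length out + 4 * n \<le> D" "D + 1 + n < W"
  shows "reaches W return_edges_loop s (n * 11 + 1)
    (ready d n1 n2 xs D (out @ concat (map quad (map (\<lambda>i. (Suc i, 0, 0, 0)) [0..<n]))))"
proof -
  define ok where "ok k = out @ concat (map quad (map (\<lambda>i. (Suc i, 0, 0, 0)) [0..<k]))" for k
  have ok_Suc: "ok (Suc k) = ok k @ [Suc k, 0, 0, 0]" for k
    by (simp add: ok_def quad_def)
  have len: "length (ok k) = length out + 4 * k" for k
    by (induction k) (simp_all add: ok_Suc, simp add: ok_def)
  let ?I = "\<lambda>k s. ready d n1 n2 xs D (ok k) s \<and> fst s 11 = Suc k \<and> fst s 9 = n - k"
  have "reaches W return_edges_loop s (n * (10 + 1) + 1) (?I n)"
    unfolding return_edges_loop_def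
  proof (rule reaches_While[where I="?I"])
    fix k s assume "k < n" "?I k s"
    moreover obtain R M where "s = (R, M)" by (cases s)
    ultimately show "fst s 9 \<noteq> 0 \<and>
        reaches W (seqs [emit 11, emit 1, emit 1, emit 1, incr 11, decr 9]) s 10 (?I (Suc k))"
      using assms(4,5) mem_inv_snoc4[of xs D "ok k" M "Suc k" 0 0 0]
      by (auto simp: ready_def regs_def macro_defs ok_Suc len)
  qed (use assms in \<open>auto simp: ok_def\<close>)
  then show ?thesis by (rule reaches_mono) (auto simp: ok_def)
qed

definition coordinate_edges_loop :: prog where
  "coordinate_edges_loop = While 9 (seqs [Load 13 8, Op Minus 13 12 13, emit 11, emit 13, emit 2, emit 14, Op Plus 12 12 15, incr 8, decr 9])"

text \<open>Register 12 runs through the numbers \<open>3 + 3 * k\<close>, so subtracting the loaded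
  bit yields the vertex without a branch. The postcondition also keeps what the surrounding loop
  over the vectors needs: its counter, its source vertex and the advanced input pointer.\<close>

lemma coordinate_edges_loop:
  assumes "ready d n1 n2 xs D out s" "fst s 8 = D + q" "fst s 9 = d" "fst s 10 = c"
    "fst s 12 = 3" "fst s 11 = x"
    and q: "q + d \<le> length xs" and D: "length out + 4 * d \<le> D" "D + length xs + 3 + 3 * d < W"
  shows "reaches W coordinate_edges_loop s (d * 14 + 1)
    (\<lambda>s. ready d n1 n2 xs D (out @ concat (map quad (map (\<lambda>i. (x, 3 + 3 * i - xs ! (q + i), 1, Suc d)) [0..<d]))) s \<and>
       fst s 8 = D + q + d \<and> fst s 10 = c \<and> fst s 11 = x)"
proof -
  define ok where "ok k = out @ concat (map quad (map (\<lambda>i. (x, 3 + 3 * i - xs ! (q + i), 1, Suc d)) [0..<k]))" for k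
  have ok_Suc: "ok (Suc k) = ok k @ [x, 3 + 3 * k - xs ! (q + k), 1, Suc d]" for k
    by (simp add: ok_def quad_def)
  have len: "length (ok k) = length out + 4 * k" for k
    by (induction k) (simp_all add: ok_Suc, simp add: ok_def)
  let ?I = "\<lambda>k s. ready d n1 n2 xs D (ok k) s \<and> fst s 8 = D + q + k \<and> fst s 9 = d - k \<and>
    fst s 10 = c \<and> fst s 11 = x \<and> fst s 12 = 3 + 3 * k"
  have "reaches W coordinate_edges_loop s (d * (13 + 1) + 1) (?I d)"
    unfolding coordinate_edges_loop_def
  proof (rule reaches_While[where I="?I"])
    fix k s assume k: "k < d" and "?I k s"
    moreover obtain R M where "s = (R, M)" by (cases s)
    moreover have "M (D + q + k) = xs ! (q + k)" if "mem_inv xs D (ok k) M"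
      using that k q by (simp add: mem_inv_def add.assoc)
    ultimately show "fst s 9 \<noteq> 0 \<and>
        reaches W (seqs [Load 13 8, Op Minus 13 12 13, emit 11, emit 13, emit 2, emit 14, Op Plus 12 12 15, incr 8, decr 9]) s 13 (?I (Suc k))"
      using q D mem_inv_snoc4[of xs D "ok k" M x "3 + 3 * k - xs ! (q + k)" 1 "Suc d"]
      by (auto simp: ready_def regs_def macro_defs ok_Suc len)
  qed (use assms in \<open>auto simp: ok_def\<close>)
  then show ?thesis by (rule reaches_mono) (auto simp: ok_def)
qed

definition target_loop :: prog where
  "target_loop = While 9 (seqs [Load 13 8, Op Plus 13 12 13, emit 13, Op Plus 12 12 15, incr 8, decr 9])"

text \<open>In contrast to the subtraction in \<open>coordinate_edges_loop\<close>, adding the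
  loaded entry could overflow; \<open>bits\<close> excludes this.\<close>

lemma target_loop:
  assumes "ready d n1 n2 xs D out s" "fst s 8 = D + q" "fst s 9 = d" "fst s 10 = c"
    "fst s 12 = 1"
    and q: "q + d \<le> length xs" and D: "length out + 1 * d \<le> D" "D + length xs + 3 + 3 * d < W"
    and bits: "\<And>i. i < d \<Longrightarrow> xs ! (q + i) \<le> 1"
  shows "reaches W target_loop s (d * 8 + 1)
    (\<lambda>s. ready d n1 n2 xs D (out @ map (\<lambda>i. 1 + 3 * i + xs ! (q + i)) [0..<d]) s \<and>
       fst s 8 = D + q + d \<and> fst s 10 = c)"
proof -
  define ok where "ok k = out @ map (\<lambda>i. 1 + 3 * i + xs ! (q + i)) [0..<k]" for k
  have ok_Suc: "ok (Suc k) = ok k @ [1 + 3 * k + xs ! (q + k)]" for k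
    by (simp add: ok_def quad_def)
  have len: "length (ok k) = length out + 1 * k" for k
    by (induction k) (simp_all add: ok_Suc, simp add: ok_def)
  let ?I = "\<lambda>k s. ready d n1 n2 xs D (ok k) s \<and> fst s 8 = D + q + k \<and> fst s 9 = d - k \<and>
    fst s 10 = c \<and> fst s 12 = 1 + 3 * k"
  have "reaches W target_loop s (d * (7 + 1) + 1) (?I d)"
    unfolding target_loop_def
  proof (rule reaches_While[where I="?I"])
    fix k s assume k: "k < d" and "?I k s"
    moreover obtain R M where "s = (R, M)" by (cases s)
    moreover have "M (D + q + k) = xs ! (q + k)" if "mem_inv xs D (ok k) M"
      using that k q by (simp add: mem_inv_def add.assoc)
    ultimately show "fst s 9 \<noteq> 0 \<and>
        reaches W (seqs [Load 13 8, Op Plus 13 12 13, emit 13, Op Plus 12 12 15, incr 8, decr 9]) s 7 (?I (Suc k))"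
      using q D bits[OF k] mem_inv_snoc[of xs D "ok k" M "1 + 3 * k + xs ! (q + k)"]
      by (auto simp: ready_def regs_def macro_defs ok_Suc len)
  qed (use assms in \<open>auto simp: ok_def\<close>)
  then show ?thesis by (rule reaches_mono) (auto simp: ok_def)
qed

section \<open>The reduction as a word RAM program\<close>

definition vector_edges_loop :: prog where
  "vector_edges_loop = While 10 (seqs
     [seqs [emit 11, emit 1, emit 2, emit 14, Const 12 3, move 9 3],
      coordinate_edges_loop, seqs [incr 11, decr 10]])"

lemma length_concat_quad: "length (concat (map quad es)) = 4 * length es"
  by (induction es) (auto simp: quad_def)

text \<open>The input pointer is never reset: after \<open>k\<close> vectors it stands at position
  \<open>3 + k * d\<close>, and after all of them at the second family of vectors, where
  \<open>targets_loop\<close> continues.\<close>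

lemma vector_edges_loop:
  assumes "ready d n1 n2 xs D out s" "fst s 8 = D + 3" "fst s 10 = n" "fst s 11 = 2 + 3 * d"
    and L: "3 + n * d \<le> length xs"
    and D: "length out + 4 * (n * Suc d) \<le> D" "D + length xs + 3 + 3 * d + n < W"
  defines "E j \<equiv> (2 + 3 * d + j, 0, 1, Suc d) #
    map (\<lambda>i. (2 + 3 * d + j, 3 + 3 * i - xs ! (3 + j * d + i), 1, Suc d)) [0..<d]"
  shows "reaches W vector_edges_loop s (n * (d * 14 + 14) + 1)
    (\<lambda>s. ready d n1 n2 xs D (out @ concat (map quad (concat (map E [0..<n])))) s \<and>
       fst s 8 = D + 3 + n * d)"
proof -
  define ok where "ok k = out @ concat (map quad (concat (map E [0..<k])))" for k
  have ok_Suc: "ok (Suc k) = (ok k @ [2 + 3 * d + k, 0, 1, Suc d]) @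
    concat (map quad (map (\<lambda>i. (2 + 3 * d + k, 3 + 3 * i - xs ! (3 + k * d + i), 1, Suc d)) [0..<d]))" for k
    by (simp add: ok_def E_def quad_def)
  have len: "length (ok k) = length out + 4 * (k * Suc d)" for k
    by (induction k) (simp_all add: ok_Suc length_concat_quad del: map_map, simp add: ok_def)
  let ?I = "\<lambda>k s. ready d n1 n2 xs D (ok k) s \<and> fst s 8 = D + 3 + k * d \<and> fst s 10 = n - k \<and>
    fst s 11 = 2 + 3 * d + k"
  have "reaches W vector_edges_loop s (n * ((d * 14 + 13) + 1) + 1) (?I n)"
    unfolding vector_edges_loop_def
  proof (rule reaches_While[where I="?I"])
    fix k s assume k: "k < n" and I: "?I k s"
    obtain R M where s: "s = (R, M)" by (cases s)
    have "Suc k * Suc d \<le> n * Suc d" "Suc k * d \<le> n * d"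
      using k by (intro mult_le_mono; simp)+
    then have kd: "length (ok k) + 4 * Suc d \<le> D" "3 + k * d + d \<le> length xs"
      using D L by (simp_all add: len)
    have 1: "reaches W (seqs [emit 11, emit 1, emit 2, emit 14, Const 12 3, move 9 3]) s 10
      (\<lambda>s. ready d n1 n2 xs D (ok k @ [2 + 3 * d + k, 0, 1, Suc d]) s \<and> fst s 8 = D + (3 + k * d) \<and>
        fst s 9 = d \<and> fst s 10 = n - k \<and> fst s 11 = 2 + 3 * d + k \<and> fst s 12 = 3)"
      using D k kd I s mem_inv_snoc4[of xs D "ok k" M "2 + 3 * d + k" 0 1 "Suc d"]
      by (auto simp: ready_def regs_def macro_defs)
    have 2: "reaches W coordinate_edges_loop s (d * 14 + 1)
        (\<lambda>s. ready d n1 n2 xs D (ok (Suc k)) s \<and>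
           fst s 8 = D + (3 + k * d) + d \<and> fst s 10 = n - k \<and> fst s 11 = 2 + 3 * d + k)"
      if "ready d n1 n2 xs D (ok k @ [2 + 3 * d + k, 0, 1, Suc d]) s \<and> fst s 8 = D + (3 + k * d) \<and>
        fst s 9 = d \<and> fst s 10 = n - k \<and> fst s 11 = 2 + 3 * d + k \<and> fst s 12 = 3" for s
      unfolding ok_Suc using that kd D by (intro coordinate_edges_loop) auto
    have 3: "reaches W (seqs [incr 11, decr 10]) s 2 (?I (Suc k))"
      if "ready d n1 n2 xs D (ok (Suc k)) s \<and>
           fst s 8 = D + (3 + k * d) + d \<and> fst s 10 = n - k \<and> fst s 11 = 2 + 3 * d + k" for s
      using that k D by (cases s) (auto simp: ready_def regs_def macro_defs)
    have "reaches W (seqs [seqs [emit 11, emit 1, emit 2, emit 14, Const 12 3, move 9 3],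
        coordinate_edges_loop, seqs [incr 11, decr 10]]) s (d * 14 + 13) (?I (Suc k))"
      unfolding seqs.simps(3)[of "seqs _"] seqs.simps(3)[of coordinate_edges_loop] seqs.simps(2)[of "seqs _"]
      by (rule reaches_SeqI[OF 1, where T'="d * 14 + 3"], rule reaches_SeqI[OF 2], assumption, erule 3) auto
    then show "fst s 10 \<noteq> 0 \<and> reaches W (seqs
        [seqs [emit 11, emit 1, emit 2, emit 14, Const 12 3, move 9 3],
        coordinate_edges_loop, seqs [incr 11, decr 10]]) s (d * 14 + 13) (?I (Suc k))"
      using I k by simp
  qed (use assms in \<open>auto simp: ok_def\<close>)
  then show ?thesis by (rule reaches_mono) (auto simp: ok_def)
qed

definition targets_loop :: prog where
  "targets_loop = While 10 (seqs
     [seqs [emit 14, emit 16, move 12 2, move 9 3], target_loop, decr 10])"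

lemma targets_loop:
  assumes "ready d n1 n2 xs D out s" "fst s 8 = D + q" "fst s 10 = n"
    and L: "q + n * d \<le> length xs"
    and D: "length out + n * (d + 2) \<le> D" "D + length xs + 3 + 3 * d + n < W"
    and bits: "\<And>j i. j < n \<Longrightarrow> i < d \<Longrightarrow> xs ! (q + j * d + i) \<le> 1"
  defines "E j \<equiv> Suc d # (1 + 3 * d) # map (\<lambda>i. 1 + 3 * i + xs ! (q + j * d + i)) [0..<d]"
  shows "reaches W targets_loop s (n * (d * 8 + 9) + 1)
    (ready d n1 n2 xs D (out @ concat (map E [0..<n])))"
proof -
  define ok where "ok k = out @ concat (map E [0..<k])" for k
  have ok_Suc: "ok (Suc k) = (ok k @ [Suc d, 1 + 3 * d]) @
    map (\<lambda>i. 1 + 3 * i + xs ! (q + k * d + i)) [0..<d]" for k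
    by (simp add: ok_def E_def)
  have len: "length (ok k) = length out + k * (d + 2)" for k
    by (induction k) (simp_all add: ok_Suc, simp add: ok_def)
  let ?I = "\<lambda>k s. ready d n1 n2 xs D (ok k) s \<and> fst s 8 = D + q + k * d \<and> fst s 10 = n - k"
  have "reaches W targets_loop s (n * ((d * 8 + 8) + 1) + 1) (?I n)"
    unfolding targets_loop_def
  proof (rule reaches_While[where I="?I"])
    fix k s assume k: "k < n" and I: "?I k s"
    obtain R M where s: "s = (R, M)" by (cases s)
    have "Suc k * (d + 2) \<le> n * (d + 2)" "Suc k * d \<le> n * d"
      using k by (intro mult_le_mono; simp)+
    then have kd: "length (ok k) + (d + 2) \<le> D" "q + k * d + d \<le> length xs"
      using D L by (simp_all add: len)
    have 1: "reaches W (seqs [emit 14, emit 16, move 12 2, move 9 3]) s 6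
      (\<lambda>s. ready d n1 n2 xs D (ok k @ [Suc d, 1 + 3 * d]) s \<and> fst s 8 = D + (q + k * d) \<and>
        fst s 9 = d \<and> fst s 10 = n - k \<and> fst s 12 = 1)"
      using D k kd I s mem_inv_snoc2[of xs D "ok k" M "Suc d" "1 + 3 * d"]
      by (auto simp: ready_def regs_def macro_defs)
    have 2: "reaches W target_loop s (d * 8 + 1)
        (\<lambda>s. ready d n1 n2 xs D (ok (Suc k)) s \<and> fst s 8 = D + (q + k * d) + d \<and> fst s 10 = n - k)"
      if "ready d n1 n2 xs D (ok k @ [Suc d, 1 + 3 * d]) s \<and> fst s 8 = D + (q + k * d) \<and>
        fst s 9 = d \<and> fst s 10 = n - k \<and> fst s 12 = 1" for s
      unfolding ok_Suc using that kd D bits[OF k] by (intro target_loop) auto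
    have 3: "reaches W (decr 10) s 1 (?I (Suc k))"
      if "ready d n1 n2 xs D (ok (Suc k)) s \<and> fst s 8 = D + (q + k * d) + d \<and> fst s 10 = n - k" for s
      using that k D by (cases s) (auto simp: ready_def regs_def macro_defs)
    have "reaches W (seqs [seqs [emit 14, emit 16, move 12 2, move 9 3], target_loop, decr 10])
        s (d * 8 + 8) (?I (Suc k))"
      unfolding seqs.simps(3)[of "seqs _"] seqs.simps(3)[of target_loop] seqs.simps(2)[of "decr _"]
      by (rule reaches_SeqI[OF 1, where T'="d * 8 + 2"], rule reaches_SeqI[OF 2], assumption, erule 3) auto
    then show "fst s 10 \<noteq> 0 \<and> reaches W (seqs
        [seqs [emit 14, emit 16, move 12 2, move 9 3], target_loop, decr 10])
        s (d * 8 + 8) (?I (Suc k))"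
      using I k by simp
  qed (use assms in \<open>auto simp: ok_def\<close>)
  then show ?thesis by (rule reaches_mono) (auto simp: ok_def)
qed

section \<open>Input copy, clean-up and layout\<close>

definition copy_loop :: prog where
  "copy_loop = While 12 (seqs [decr 12, Load 13 12, Op Plus 11 6 12, Store 11 13])"

text \<open>Since \<open>length xs \<le> D\<close>, no source cell is overwritten. Register 12 runs
  downwards and serves both as counter and as source address.\<close>

lemma copy_loop:
  assumes "regs d n1 n2 xs D (fst s)" "fst s 8 = a" "fst s 9 = b" "fst s 12 = length xs"
    and "snd s = (\<lambda>i. if i < length xs then xs ! i else 0)"
    and D: "length xs \<le> D" "D + length xs < W"
  shows "reaches W copy_loop s (length xs * 5 + 1)
    (\<lambda>s. regs d n1 n2 xs D (fst s) \<and> fst s 8 = a \<and> fst s 9 = b \<and> mem_inv xs D [] (snd s))"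
proof -
  let ?I = "\<lambda>k s. regs d n1 n2 xs D (fst s) \<and> fst s 8 = a \<and> fst s 9 = b \<and> fst s 12 = length xs - k \<and>
    (\<forall>i<length xs. snd s i = xs ! i) \<and>
    (\<forall>i<length xs. length xs - k \<le> i \<longrightarrow> snd s (D + i) = xs ! i) \<and>
    (\<forall>i\<ge>D + length xs. snd s i = 0)"
  have "reaches W copy_loop s (length xs * (4 + 1) + 1) (?I (length xs))"
    unfolding copy_loop_def
  proof (rule reaches_While[where I="?I"])
    fix k s assume "k < length xs" "?I k s"
    moreover obtain R M where "s = (R, M)" by (cases s)
    ultimately show "fst s 12 \<noteq> 0 \<and>
        reaches W (seqs [decr 12, Load 13 12, Op Plus 11 6 12, Store 11 13]) s 4 (?I (Suc k))"
      using D by (auto simp: regs_def macro_defs intro!: arg_cong[where f="(!) xs"])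
  qed (use assms in auto)
  then show ?thesis by (rule reaches_mono) (auto simp: mem_inv_def)
qed

definition clear_loop :: prog where
  "clear_loop = While 12 (seqs [decr 12, Op Plus 11 6 12, Store 11 1])"

text \<open>A subsequent algorithm needs exactly the state \<open>initial_state out\<close>, so the
  copy is erased. It begins right behind the output, because \<open>length out = D\<close>.\<close>

lemma clear_loop:
  assumes "ready d n1 n2 xs D out s" "fst s 12 = length xs" "length out = D" "D + length xs < W"
  shows "reaches W clear_loop s (length xs * 4 + 1)
    (\<lambda>s. fst s 0 = D \<and> regs d n1 n2 xs D (fst s) \<and>
       snd s = (\<lambda>i. if i < length out then out ! i else 0))"
proof -
  let ?I = "\<lambda>k s. fst s 0 = D \<and> regs d n1 n2 xs D (fst s) \<and> fst s 12 = length xs - k \<and>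
    (\<forall>i<D. snd s i = out ! i) \<and> (\<forall>i\<ge>D + (length xs - k). snd s i = 0)"
  have "reaches W clear_loop s (length xs * (3 + 1) + 1) (?I (length xs))"
    unfolding clear_loop_def
  proof (rule reaches_While[where I="?I"])
    fix k s assume "k < length xs" "?I k s"
    moreover obtain R M where "s = (R, M)" by (cases s)
    ultimately show "fst s 12 \<noteq> 0 \<and>
        reaches W (seqs [decr 12, Op Plus 11 6 12, Store 11 1]) s 3 (?I (Suc k))"
      using assms(3,4) by (auto simp: regs_def macro_defs)
  qed (use assms in \<open>auto simp: ready_def mem_inv_def\<close>)
  then show ?thesis by (rule reaches_mono) (auto simp: assms(3))
qed

definition clear_regs :: prog where
  "clear_regs = seqs (map (\<lambda>r. Const r 0) [2, 3, 4, 5, 6, 7, 8, 9, 10, 11, 12, 13, 14, 15, 16])"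

text \<open>The write pointer in register 0 already equals the length of the output, as
  \<open>initial_state\<close> requires; \<open>regs\<close> supplies the zeros in register 1 and
  from register 17 on.\<close>

lemma clear_regs:
  assumes "fst s 0 = length out" "regs d n1 n2 xs D (fst s)"
    "snd s = (\<lambda>i. if i < length out then out ! i else 0)" "0 < W"
  shows "reaches W clear_regs s 15 (\<lambda>s. s = initial_state out)"
proof -
  obtain R M where s: "s = (R, M)" by (cases s)
  have "R(2 := 0, 3 := 0, 4 := 0, 5 := 0, 6 := 0, 7 := 0, 8 := 0, 9 := 0, 10 := 0, 11 := 0,
      12 := 0, 13 := 0, 14 := 0, 15 := 0, 16 := 0) = (\<lambda>_. 0)(0 := length out)" (is "?R = _")
  proof
    fix r :: nat
    have "r = 0 \<or> r = 1 \<or> r = 2 \<or> r = 3 \<or> r = 4 \<or> r = 5 \<or> r = 6 \<or> r = 7 \<or> r = 8 \<or> r = 9 \<or> r = 10 \<or>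
      r = 11 \<or> r = 12 \<or> r = 13 \<or> r = 14 \<or> r = 15 \<or> r = 16 \<or> r \<ge> 17"
      by presburger
    then show "?R r = ((\<lambda>_. 0)(0 := length out)) r"
      using assms s by (elim disjE) (simp_all add: regs_def)
  qed
  then show ?thesis
    using assms s by (simp add: clear_regs_def initial_state_def)
qed

text \<open>Sizes are computed before anything is written: the number of vertices in register 8, of
  edges in 9, and the start \<open>D\<close> of the copy in 6. The flag \<open>b\<close> asks for an
  additional leading \<open>0\<close>, the queried vertex of a membership instance.\<close>

definition layout_prog :: "bool \<Rightarrow> prog" where
  "layout_prog b = seqs (
     [Const 2 1, Load 3 1, Load 4 2, Const 13 2, Load 5 13, move 7 0, Op Plus 14 3 2, Const 15 3,
      Op Times 16 15 3, incr 16, Op Plus 8 16 2, Op Plus 8 8 4,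
      Op Plus 10 14 2, Op Times 9 4 10, Op Plus 9 9 16, incr 9,
      Op Times 11 5 10, Const 12 4, Op Times 12 12 9, Op Plus 11 11 12, Op Plus 11 11 8, Op Plus 6 11 15] @
     (if b then [incr 6] else []) @ [move 12 7])"

text \<open>The summands are the header, one entry per vertex, four per edge, \<open>d + 2\<close>
  per target set, and the queried vertex.\<close>

definition instance_length :: "bool \<Rightarrow> nat \<Rightarrow> nat \<Rightarrow> nat \<Rightarrow> nat" where
  "instance_length b d n1 n2 =
     3 + (2 + 3 * d + n1) + 4 * (n1 * (d + 2) + 3 * d + 2) + n2 * (d + 2) + (if b then 1 else 0)"

lemma layout_prog:
  assumes xs: "xs = [d, n1, n2] @ ys"
    and W: "instance_length b d n1 n2 + length xs < W"
  shows "reaches W (layout_prog b) (initial_state xs) 24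
    (\<lambda>s. regs d n1 n2 xs (instance_length b d n1 n2) (fst s) \<and> fst s 8 = 2 + 3 * d + n1 \<and>
       fst s 9 = n1 * (d + 2) + 3 * d + 2 \<and> fst s 12 = length xs \<and>
       snd s = (\<lambda>i. if i < length xs then xs ! i else 0))"
  using W
  by (cases b) (auto simp: layout_prog_def initial_state_def macro_defs regs_def instance_length_def xs
      algebra_simps)

definition header_prog :: "bool \<Rightarrow> prog" where
  "header_prog b = seqs ([Const 0 0] @ (if b then [emit 1] else []) @
     [emit 8, emit 9, emit 5, Op Plus 9 16 2])"

lemma header_prog:
  assumes "regs d n1 n2 xs D (fst s)" "fst s 8 = n" "fst s 9 = m" "mem_inv xs D [] (snd s)"
    and D: "4 \<le> D" "D < W" "3 * d + 2 < W"
  shows "reaches W (header_prog b) s 10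
    (\<lambda>s. ready d n1 n2 xs D ((if b then [0] else []) @ [n, m, n2]) s \<and> fst s 9 = 2 + 3 * d)"
proof -
  obtain R M where s: "s = (R, M)" by (cases s)
  have "mem_inv xs D [0, n, m, n2] (M(0 := 0, 1 := n, 2 := m, 3 := n2))"
    using assms s mem_inv_snoc4[of xs D "[]" M 0 n m n2] by (simp add: numeral_eq_Suc)
  moreover have "mem_inv xs D [n, m, n2] (M(0 := n, 1 := m, 2 := n2))"
    using assms s mem_inv_snoc2[of xs D "[]" M n m] mem_inv_snoc[of xs D "[n, m]" _ n2]
    by (simp add: numeral_eq_Suc)
  ultimately show ?thesis
    using assms s
    by (cases b) (auto simp: header_prog_def ready_def regs_def macro_defs numeral_2_eq_2 numeral_3_eq_3)
qed

text \<open>The arguments of \<open>fill_loop\<close> are registers: register 2 holds the 1 that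
  marks player-1 vertices, register 1 the 0 that marks random ones.\<close>

definition reduction_prog :: "bool \<Rightarrow> prog" where
  "reduction_prog b =
     Seq (layout_prog b) (
     Seq copy_loop (
     Seq (header_prog b) (
     Seq (fill_loop 2) (
     Seq (move 9 4) (
     Seq (fill_loop 1) (
     Seq (seqs [Op Plus 9 4 2, move 11 16]) (
     Seq start_edges_loop (
     Seq (seqs [move 9 16, move 11 2]) (
     Seq return_edges_loop (
     Seq (seqs [move 10 4, Op Plus 11 16 2, Op Plus 8 6 15]) (
     Seq vector_edges_loop (
     Seq (move 10 5) (
     Seq targets_loop (
     Seq (move 12 7) (
     Seq clear_loop clear_regs)))))))))))))))"

lemma nth_concat_uniform:
  assumes "\<forall>u\<in>set us. length u = d" "j < length us" "i < d"
  shows "concat us ! (j * d + i) = us ! j ! i"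
  using assms
proof (induction us arbitrary: j)
  case (Cons u us)
  then show ?case
    by (cases j) (auto simp: nth_append)
qed simp

lemma length_concat_uniform:
  "\<forall>u\<in>set us. length u = d \<Longrightarrow> length (concat us) = length us * d"
  by (induction us) auto

text \<open>The parts of the program are verified separately (facts \<open>a2\<close> to
  \<open>a15\<close>, with \<open>s1\<close> and \<open>s17\<close> at the ends) and chained from
  the last to the first (the remaining facts \<open>s16\<close> down to \<open>s2\<close>).\<close>

lemma reduction_prog:
  fixes us vs :: "nat list list" and b :: bool
  assumes us: "\<forall>u\<in>set us. bit_vector d u" and vs: "\<forall>v\<in>set vs. bit_vector d v"
  defines "xs \<equiv> [d, length us, length vs] @ concat us @ concat vs"
    and "out \<equiv> (if b then [0] else []) @ ov_instance d us vs"
  assumes W: "2 * length out + length xs + 4 < W"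
  shows "reaches W (reduction_prog b) (initial_state xs) (60 * length out) (\<lambda>s. s = initial_state out)"
proof -
  let ?n1 = "length us" and ?n2 = "length vs"
  define D where "D = instance_length b d ?n1 ?n2"
  have lens: "\<forall>u\<in>set us. length u = d" "\<forall>v\<in>set vs. length v = d"
    using us vs by (auto simp: bit_vector_def)
  have L: "length xs = 3 + ?n1 * d + ?n2 * d"
    by (simp add: xs_def length_concat_uniform[OF lens(1)] length_concat_uniform[OF lens(2)])
  have read1: "xs ! (3 + j * d + i) = us ! j ! i" if "j < ?n1" "i < d" for j i
  proof -
    have "Suc j * d \<le> ?n1 * d" using that by (intro mult_le_mono) auto
    then have "j * d + i < length (concat us)"
      using that by (simp add: length_concat_uniform[OF lens(1)])
    then show ?thesis
      using that nth_concat_uniform[OF lens(1) that]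
      by (simp add: xs_def nth_append add.assoc numeral_3_eq_3)
  qed
  have read2: "xs ! (3 + ?n1 * d + j * d + i) = vs ! j ! i" if "j < ?n2" "i < d" for j i
    using nth_concat_uniform[OF lens(2) that]
    by (simp add: xs_def nth_append add.assoc numeral_3_eq_3 length_concat_uniform[OF lens(1)])
  have bits2: "xs ! (3 + ?n1 * d + j * d + i) \<le> 1" if "j < ?n2" "i < d" for j i
    using read2[OF that] bit_vector_nth_le[of d "vs ! j" i] vs that by simp
  \<comment> \<open>\<open>o1\<close> to \<open>o7\<close> are the outputs after the successive
    writing phases.\<close>
  define o1 where "o1 = (if b then [0] else []) @ [2 + 3 * d + ?n1, ?n1 * (d + 2) + 3 * d + 2, ?n2]"
  define o2 where "o2 = o1 @ replicate (2 + 3 * d) 1"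
  define o3 where "o3 = o2 @ replicate ?n1 0"
  define o4 where "o4 = o3 @ concat (map quad (map (\<lambda>i. (0, 1 + 3 * d + i, 0, 0)) [0..<Suc ?n1]))"
  define o5 where "o5 = o4 @ concat (map quad (map (\<lambda>i. (Suc i, 0, 0, 0)) [0..<Suc (3 * d)]))"
  define o6 where "o6 = o5 @ concat (map quad (concat (map (\<lambda>j. (2 + 3 * d + j, 0, 1, Suc d) #
    map (\<lambda>i. (2 + 3 * d + j, 3 + 3 * i - xs ! (3 + j * d + i), 1, Suc d)) [0..<d]) [0..<?n1])))"
  define o7 where "o7 = o6 @ concat (map (\<lambda>j. Suc d # (1 + 3 * d) #
    map (\<lambda>i. 1 + 3 * i + xs ! (3 + ?n1 * d + j * d + i)) [0..<d]) [0..<?n2])"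
  \<comment> \<open>The program reads the vectors at positions of the flat input; this and the next
    equation rewrite those reads to entries of \<open>us\<close> and \<open>vs\<close>.\<close>
  have edges_eq: "map (\<lambda>j. (2 + 3 * d + j, 0, 1, Suc d) #
      map (\<lambda>i. (2 + 3 * d + j, 3 + 3 * i - xs ! (3 + j * d + i), 1, Suc d)) [0..<d]) [0..<?n1] =
      map (ov_vector_edges d us) [0..<?n1]"
    by (intro map_cong refl) (simp add: ov_vector_edges_def read1)
  have targets_eq: "map (\<lambda>j. Suc d # (1 + 3 * d) #
      map (\<lambda>i. 1 + 3 * i + xs ! (3 + ?n1 * d + j * d + i)) [0..<d]) [0..<?n2] =
      map (\<lambda>v. Suc d # ov_target_list d v) vs"
    by (rule nth_equalityI) (auto simp: ov_target_list_def read2)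
  have out: "o7 = out"
    unfolding o7_def o6_def o5_def o4_def o3_def o2_def o1_def edges_eq targets_eq
      out_def ov_instance_def length_ov_edges[of d us, symmetric] quad_def[symmetric]
    unfolding ov_edges_def
    by (simp only: map_append concat_append append_assoc)
  have l1: "length o1 = 3 + (if b then 1 else 0)" by (simp add: o1_def)
  have l2: "length o2 = length o1 + (2 + 3 * d)" by (simp add: o2_def)
  have l3: "length o3 = length o2 + ?n1" by (simp add: o3_def)
  have l4: "length o4 = length o3 + 4 * Suc ?n1"
    by (simp only: o4_def length_append length_concat_quad length_map length_upt diff_zero)
  have l5: "length o5 = length o4 + 4 * Suc (3 * d)"
    by (simp only: o5_def length_append length_concat_quad length_map length_upt diff_zero)
  have l6: "length o6 = length o5 + 4 * (?n1 * Suc d)"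
    unfolding o6_def length_append length_concat_quad
    by (simp add: length_concat comp_def sum_list_triv)
  have l7: "length o7 = length o6 + ?n2 * (d + 2)"
    by (simp add: o7_def length_concat comp_def sum_list_triv)
  have D: "length out = D"
    unfolding out[symmetric] l7 l6 l5 l4 l3 l2 l1 D_def instance_length_def
    by (simp add: algebra_simps)
  have LD: "length xs \<le> D"
    unfolding L D_def instance_length_def by (simp add: algebra_simps)
  have bounds: "length o1 + (2 + 3 * d) \<le> D" "length o2 + ?n1 \<le> D" "length o3 + 4 * Suc ?n1 \<le> D"
    "length o4 + 4 * Suc (3 * d) \<le> D" "length o5 + 4 * (?n1 * Suc d) \<le> D"
    "length o6 + ?n2 * (d + 2) \<le> D"
    using l2 l3 l4 l5 l6 l7 D out by auto
  have W': "2 * D + length xs + 4 < W" using W D by simp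
  have big: "4 \<le> D" "3 * d + ?n1 + ?n2 + 2 < D"
    unfolding D_def instance_length_def by auto
  let ?r = "ready d ?n1 ?n2 xs D"
  have s1: "reaches W (layout_prog b) (initial_state xs) 24
    (\<lambda>s. regs d ?n1 ?n2 xs D (fst s) \<and> fst s 8 = 2 + 3 * d + ?n1 \<and>
       fst s 9 = ?n1 * (d + 2) + 3 * d + 2 \<and> fst s 12 = length xs \<and>
       snd s = (\<lambda>i. if i < length xs then xs ! i else 0))"
    unfolding D_def by (rule layout_prog) (use W' in \<open>simp_all add: xs_def D_def\<close>)
  have s17: "reaches W clear_regs s 15 (\<lambda>s. s = initial_state out)"
    if "fst s 0 = D \<and> regs d ?n1 ?n2 xs D (fst s) \<and> snd s = (\<lambda>i. if i < length out then out ! i else 0)" for s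
    using that D W' by (intro clear_regs) auto
  have s16: "reaches W (Seq clear_loop clear_regs) s (length xs * 4 + 16) (\<lambda>s. s = initial_state out)"
    if "?r out s \<and> fst s 12 = length xs" for s
    by (rule reaches_SeqI[OF clear_loop s17]) (use that D W' in auto)
  let ?p16 = "Seq clear_loop clear_regs" and ?t16 = "length xs * 4 + 16"
  let ?p15 = "Seq (move 12 7) ?p16" and ?t15 = "(1) + ?t16"
  have a15: "reaches W (move 12 7) s (1) (\<lambda>s. ?r out s \<and> fst s 12 = length xs)"
    if "?r out s" for s
    using that W' big D_def by (cases s) (auto simp: ready_def regs_def macro_defs)
  have s15: "reaches W ?p15 s ?t15 (\<lambda>s. s = initial_state out)"
    if "?r out s" for s
    by (rule reaches_SeqI[OF a15[OF that] s16 order_refl])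
  let ?p14 = "Seq targets_loop ?p15" and ?t14 = "(?n2 * (d * 8 + 9) + 1) + ?t15"
  have a14: "reaches W targets_loop s (?n2 * (d * 8 + 9) + 1) (\<lambda>s. ?r out s)"
    if "?r o6 s \<and> fst s 8 = D + (3 + ?n1 * d) \<and> fst s 10 = ?n2" for s
    unfolding out[symmetric] o7_def using that L bounds W' big bits2 by (intro targets_loop) auto
  have s14: "reaches W ?p14 s ?t14 (\<lambda>s. s = initial_state out)"
    if "?r o6 s \<and> fst s 8 = D + (3 + ?n1 * d) \<and> fst s 10 = ?n2" for s
    by (rule reaches_SeqI[OF a14[OF that] s15 order_refl])
  let ?p13 = "Seq (move 10 5) ?p14" and ?t13 = "(1) + ?t14"
  have a13: "reaches W (move 10 5) s (1) (\<lambda>s. ?r o6 s \<and> fst s 8 = D + (3 + ?n1 * d) \<and> fst s 10 = ?n2)"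
    if "?r o6 s \<and> fst s 8 = D + 3 + ?n1 * d" for s
    using that W' big D_def by (cases s) (auto simp: ready_def regs_def macro_defs)
  have s13: "reaches W ?p13 s ?t13 (\<lambda>s. s = initial_state out)"
    if "?r o6 s \<and> fst s 8 = D + 3 + ?n1 * d" for s
    by (rule reaches_SeqI[OF a13[OF that] s14 order_refl])
  let ?p12 = "Seq vector_edges_loop ?p13" and ?t12 = "(?n1 * (d * 14 + 14) + 1) + ?t13"
  have a12: "reaches W vector_edges_loop s (?n1 * (d * 14 + 14) + 1) (\<lambda>s. ?r o6 s \<and> fst s 8 = D + 3 + ?n1 * d)"
    if "?r o5 s \<and> fst s 8 = D + 3 \<and> fst s 10 = ?n1 \<and> fst s 11 = 2 + 3 * d" for s
    unfolding o6_def using that L bounds W' big by (intro vector_edges_loop) auto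
  have s12: "reaches W ?p12 s ?t12 (\<lambda>s. s = initial_state out)"
    if "?r o5 s \<and> fst s 8 = D + 3 \<and> fst s 10 = ?n1 \<and> fst s 11 = 2 + 3 * d" for s
    by (rule reaches_SeqI[OF a12[OF that] s13 order_refl])
  let ?p11 = "Seq (seqs [move 10 4, Op Plus 11 16 2, Op Plus 8 6 15]) ?p12" and ?t11 = "(3) + ?t12"
  have a11: "reaches W (seqs [move 10 4, Op Plus 11 16 2, Op Plus 8 6 15]) s (3) (\<lambda>s. ?r o5 s \<and> fst s 8 = D + 3 \<and> fst s 10 = ?n1 \<and> fst s 11 = 2 + 3 * d)"
    if "?r o5 s" for s
    using that W' big D_def by (cases s) (auto simp: ready_def regs_def macro_defs)
  have s11: "reaches W ?p11 s ?t11 (\<lambda>s. s = initial_state out)"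
    if "?r o5 s" for s
    by (rule reaches_SeqI[OF a11[OF that] s12 order_refl])
  let ?p10 = "Seq return_edges_loop ?p11" and ?t10 = "(Suc (3 * d) * 11 + 1) + ?t11"
  have a10: "reaches W return_edges_loop s (Suc (3 * d) * 11 + 1) (\<lambda>s. ?r o5 s)"
    if "?r o4 s \<and> fst s 9 = Suc (3 * d) \<and> fst s 11 = 1" for s
    unfolding o5_def using that bounds W' big by (intro return_edges_loop) auto
  have s10: "reaches W ?p10 s ?t10 (\<lambda>s. s = initial_state out)"
    if "?r o4 s \<and> fst s 9 = Suc (3 * d) \<and> fst s 11 = 1" for s
    by (rule reaches_SeqI[OF a10[OF that] s11 order_refl])
  let ?p9 = "Seq (seqs [move 9 16, move 11 2]) ?p10" and ?t9 = "(2) + ?t10"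
  have a9: "reaches W (seqs [move 9 16, move 11 2]) s (2) (\<lambda>s. ?r o4 s \<and> fst s 9 = Suc (3 * d) \<and> fst s 11 = 1)"
    if "?r o4 s" for s
    using that W' big D_def by (cases s) (auto simp: ready_def regs_def macro_defs)
  have s9: "reaches W ?p9 s ?t9 (\<lambda>s. s = initial_state out)"
    if "?r o4 s" for s
    by (rule reaches_SeqI[OF a9[OF that] s10 order_refl])
  let ?p8 = "Seq start_edges_loop ?p9" and ?t8 = "(Suc ?n1 * 11 + 1) + ?t9"
  have a8: "reaches W start_edges_loop s (Suc ?n1 * 11 + 1) (\<lambda>s. ?r o4 s)"
    if "?r o3 s \<and> fst s 9 = Suc ?n1 \<and> fst s 11 = 1 + 3 * d" for s
    unfolding o4_def using that bounds W' big by (intro start_edges_loop) auto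
  have s8: "reaches W ?p8 s ?t8 (\<lambda>s. s = initial_state out)"
    if "?r o3 s \<and> fst s 9 = Suc ?n1 \<and> fst s 11 = 1 + 3 * d" for s
    by (rule reaches_SeqI[OF a8[OF that] s9 order_refl])
  let ?p7 = "Seq (seqs [Op Plus 9 4 2, move 11 16]) ?p8" and ?t7 = "(2) + ?t8"
  have a7: "reaches W (seqs [Op Plus 9 4 2, move 11 16]) s (2) (\<lambda>s. ?r o3 s \<and> fst s 9 = Suc ?n1 \<and> fst s 11 = 1 + 3 * d)"
    if "?r o3 s" for s
    using that W' big D_def by (cases s) (auto simp: ready_def regs_def macro_defs)
  have s7: "reaches W ?p7 s ?t7 (\<lambda>s. s = initial_state out)"
    if "?r o3 s" for s
    by (rule reaches_SeqI[OF a7[OF that] s8 order_refl])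
  let ?p6 = "Seq (fill_loop 1) ?p7" and ?t6 = "(?n1 * 4 + 1) + ?t7"
  have a6: "reaches W (fill_loop 1) s (?n1 * 4 + 1) (\<lambda>s. ?r o3 s)"
    if "?r o2 s \<and> fst s 9 = ?n1" for s
    unfolding o3_def using that bounds W' by (intro fill_loop) auto
  have s6: "reaches W ?p6 s ?t6 (\<lambda>s. s = initial_state out)"
    if "?r o2 s \<and> fst s 9 = ?n1" for s
    by (rule reaches_SeqI[OF a6[OF that] s7 order_refl])
  let ?p5 = "Seq (move 9 4) ?p6" and ?t5 = "(1) + ?t6"
  have a5: "reaches W (move 9 4) s (1) (\<lambda>s. ?r o2 s \<and> fst s 9 = ?n1)"
    if "?r o2 s" for s
    using that W' big D_def by (cases s) (auto simp: ready_def regs_def macro_defs)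
  have s5: "reaches W ?p5 s ?t5 (\<lambda>s. s = initial_state out)"
    if "?r o2 s" for s
    by (rule reaches_SeqI[OF a5[OF that] s6 order_refl])
  let ?p4 = "Seq (fill_loop 2) ?p5" and ?t4 = "((2 + 3 * d) * 4 + 1) + ?t5"
  have a4: "reaches W (fill_loop 2) s ((2 + 3 * d) * 4 + 1) (\<lambda>s. ?r o2 s)"
    if "?r o1 s \<and> fst s 9 = 2 + 3 * d" for s
    unfolding o2_def using that bounds W' by (intro fill_loop) auto
  have s4: "reaches W ?p4 s ?t4 (\<lambda>s. s = initial_state out)"
    if "?r o1 s \<and> fst s 9 = 2 + 3 * d" for s
    by (rule reaches_SeqI[OF a4[OF that] s5 order_refl])
  let ?p3 = "Seq (header_prog b) ?p4" and ?t3 = "(10) + ?t4"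
  have a3: "reaches W (header_prog b) s (10) (\<lambda>s. ?r o1 s \<and> fst s 9 = 2 + 3 * d)"
    if "regs d ?n1 ?n2 xs D (fst s) \<and> fst s 8 = 2 + 3 * d + ?n1 \<and> fst s 9 = ?n1 * (d + 2) + 3 * d + 2 \<and> mem_inv xs D [] (snd s)" for s
    unfolding o1_def using that W' big by (intro header_prog) auto
  have s3: "reaches W ?p3 s ?t3 (\<lambda>s. s = initial_state out)"
    if "regs d ?n1 ?n2 xs D (fst s) \<and> fst s 8 = 2 + 3 * d + ?n1 \<and> fst s 9 = ?n1 * (d + 2) + 3 * d + 2 \<and> mem_inv xs D [] (snd s)" for s
    by (rule reaches_SeqI[OF a3[OF that] s4 order_refl])
  let ?p2 = "Seq copy_loop ?p3" and ?t2 = "(length xs * 5 + 1) + ?t3"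
  have a2: "reaches W copy_loop s (length xs * 5 + 1) (\<lambda>s. regs d ?n1 ?n2 xs D (fst s) \<and> fst s 8 = 2 + 3 * d + ?n1 \<and> fst s 9 = ?n1 * (d + 2) + 3 * d + 2 \<and> mem_inv xs D [] (snd s))"
    if "regs d ?n1 ?n2 xs D (fst s) \<and> fst s 8 = 2 + 3 * d + ?n1 \<and> fst s 9 = ?n1 * (d + 2) + 3 * d + 2 \<and> fst s 12 = length xs \<and> snd s = (\<lambda>i. if i < length xs then xs ! i else 0)" for s
    using that LD W' by (intro copy_loop) auto
  have s2: "reaches W ?p2 s ?t2 (\<lambda>s. s = initial_state out)"
    if "regs d ?n1 ?n2 xs D (fst s) \<and> fst s 8 = 2 + 3 * d + ?n1 \<and> fst s 9 = ?n1 * (d + 2) + 3 * d + 2 \<and> fst s 12 = length xs \<and> snd s = (\<lambda>i. if i < length xs then xs ! i else 0)" for s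
    by (rule reaches_SeqI[OF a2[OF that] s3 order_refl])
  have "reaches W (reduction_prog b) (initial_state xs) (24 + ?t2) (\<lambda>s. s = initial_state out)"
    unfolding reduction_prog_def by (rule reaches_SeqI[OF s1 s2 order_refl])
  \<comment> \<open>Each loop spends constantly many steps per number read or written; 60 is a
    generous common constant.\<close>
  moreover have "24 + ?t2 \<le> 60 * length out"
    unfolding D L D_def instance_length_def by (simp add: algebra_simps)
  ultimately show ?thesis by (rule reaches_mono)
qed

section \<open>Running times\<close>

lemma length_reduction_out:
  "length ((if b then [0] else []) @ ov_instance d us vs) = instance_length b d (length us) (length vs)"
proof -
  have "length (concat (map (\<lambda>(u, v, a, b). [u, v, a, b]) es)) = 4 * length es"
    for es :: "(nat \<times> nat \<times> nat \<times> nat) list"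
    using length_concat_quad[of es] by (simp add: quad_def)
  moreover have "length (concat (map (\<lambda>v. Suc d # ov_target_list d v) vs)) = length vs * (d + 2)"
    by (simp add: length_concat comp_def sum_list_triv ov_target_list_def)
  ultimately show ?thesis
    by (simp add: ov_instance_def instance_length_def length_ov_edges)
qed

text \<open>With this bound on the entries, the word size of the instance is controlled by its
  length alone.\<close>

lemma ov_instance_entry_le:
  assumes "\<forall>u\<in>set us. bit_vector d u" "\<forall>v\<in>set vs. bit_vector d v" "y \<in> set (ov_instance d us vs)"
  shows "y \<le> instance_length b d (length us) (length vs)"
proof -
  let ?D = "instance_length b d (length us) (length vs)"
  have D: "2 + 3 * d + length us \<le> ?D" "length vs \<le> ?D" "length (ov_edges d us) \<le> ?D"
    by (simp_all add: instance_length_def length_ov_edges)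
  have tgt: "z \<le> ?D" if "v \<in> set vs" "z \<in> set (ov_target_list d v)" for v z
  proof -
    consider "z = 1 + 3 * d" | i where "i < d" "z = 1 + 3 * i + v ! i"
      using \<open>z \<in> _\<close> by (auto simp: set_ov_target_list)
    then show ?thesis
    proof cases
      case (2 i)
      then show ?thesis using bit_vector_nth_le[of d v i] assms(2) \<open>v \<in> set vs\<close> D by simp
    qed (use D in simp)
  qed
  have edge: "z \<le> ?D" if "(u, v, p, q) \<in> set (ov_edges d us)" "z \<in> {u, v, p, q}" for u v p q z
    using that D by (auto simp: ov_edges_def ov_vector_edges_def)
  have "y \<in> {2 + 3 * d + length us, length (ov_edges d us), length vs, 0, 1, Suc d} \<or>
      (\<exists>u v p q. (u, v, p, q) \<in> set (ov_edges d us) \<and> y \<in> {u, v, p, q}) \<or>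
      (\<exists>v\<in>set vs. y \<in> set (ov_target_list d v))"
    using assms(3) unfolding ov_instance_def
    by (auto simp del: replicate_Suc replicate_add simp: set_replicate_conv_if split: if_splits prod.splits)
  then show ?thesis
    using D tgt edge by (elim disjE exE bexE conjE) auto
qed

text \<open>With \<open>s\<close> the base of the word bound for \<open>xs\<close>, the instance has
  length and entries quadratic in \<open>s\<close>. The constant 64 is absorbed into
  \<open>s ^ 6\<close> because \<open>2 \<le> s\<close>, so the base for \<open>out\<close> is at
  most \<open>s ^ 8\<close>. The exponent \<open>10\<close> leaves room for the values computed by
  the reduction itself.\<close>

lemma word_bound_reduction:
  fixes us vs :: "nat list list" and b :: bool
  assumes us: "\<forall>u\<in>set us. bit_vector d u" and vs: "\<forall>v\<in>set vs. bit_vector d v"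
  defines "xs \<equiv> [d, length us, length vs] @ concat us @ concat vs"
  defines "out \<equiv> (if b then [0] else []) @ ov_instance d us vs"
  shows "word_bound c out \<le> word_bound (8 * c + 10) xs"
    and "2 * length out + length xs + 4 < word_bound (8 * c + 10) xs"
proof -
  define s where "s = 2 + length xs + Max (insert 0 (set xs))"
  have Mx: "x \<le> Max (insert 0 (set xs))" if "x \<in> set xs" for x
    using that by (intro Max_ge) auto
  have s: "d \<le> s" "length us \<le> s" "length vs \<le> s" "2 \<le> s" "length xs + 2 \<le> s"
    using Mx[of d] Mx[of "length us"] Mx[of "length vs"] by (auto simp: s_def xs_def)
  define D where "D = instance_length b d (length us) (length vs)"
  have len: "length out = D"
    by (simp only: out_def D_def length_reduction_out)
  have "D \<le> 3 + (2 + 3 * s + s) + 4 * (s * (s + 2) + 3 * s + 2) + s * (s + 2) + 1"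
    unfolding D_def instance_length_def using s by (intro add_mono mult_mono) auto
  then have "2 + 2 * D \<le> 10 * (s * s) + 52 * s + 30"
    by (simp add: algebra_simps)
  also have "\<dots> \<le> 64 * (s * s)"
  proof -
    have "2 * s \<le> s * s" "4 \<le> s * s" using s(4) mult_mono[of 2 s 2 s] by auto
    then show ?thesis by linarith
  qed
  also have "\<dots> \<le> s ^ 6 * s ^ 2"
    using power_mono[OF s(4), of 6] by (intro mult_mono) (auto simp: power2_eq_square)
  finally have D8: "2 + 2 * D \<le> s ^ 8"
    by (simp flip: power_add)
  have "Max (insert 0 (set out)) \<le> D"
    using ov_instance_entry_le[OF us vs, of _ b] by (auto simp: out_def D_def)
  then have "2 + length out + Max (insert 0 (set out)) \<le> s ^ 8"
    using D8 len by linarith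
  then have "word_bound c out \<le> (s ^ 8) ^ c"
    unfolding word_bound_def by (intro power_mono) auto
  also have "\<dots> \<le> s ^ (8 * c + 10)"
    using s(4) by (simp only: power_mult[symmetric]) (intro power_increasing, auto)
  also have "\<dots> = word_bound (8 * c + 10) xs"
    by (simp add: word_bound_def s_def)
  finally show "word_bound c out \<le> word_bound (8 * c + 10) xs" .
  have "2 * length out + length xs + 4 \<le> s ^ 8 + s"
    using D8 len s by simp
  also have "\<dots> < s ^ 8 * s ^ 2"
  proof -
    have "s ^ 1 \<le> s ^ 8" using s(4) by (intro power_increasing) auto
    moreover have "s ^ 8 * 4 \<le> s ^ 8 * s ^ 2" using power_mono[OF s(4), of 2] by (intro mult_mono) auto
    moreover have "0 < s ^ 8" using s(4) by simp
    ultimately show ?thesis by simp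
  qed
  also have "\<dots> = s ^ 10" by (simp flip: power_add)
  also have "\<dots> \<le> s ^ (8 * c + 10)"
    using s(4) by (intro power_increasing) auto
  also have "\<dots> = word_bound (8 * c + 10) xs"
    by (simp add: word_bound_def s_def)
  finally show "2 * length out + length xs + 4 < word_bound (8 * c + 10) xs" .
qed

lemma exec_after_reduction:
  assumes us: "\<forall>u\<in>set us. bit_vector d u" and vs: "\<forall>v\<in>set vs. bit_vector d v"
    and A: "exec (word_bound c out) A (initial_state out) t s"
    and out: "out = (if b then [0] else []) @ ov_instance d us vs"
    and xs: "xs = [d, length us, length vs] @ concat us @ concat vs"
  shows "\<exists>t'. exec (word_bound (8 * c + 10) xs) (Seq (reduction_prog b) A) (initial_state xs) t' s \<and>
    t' \<le> 60 * length out + t"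
proof -
  let ?W = "word_bound (8 * c + 10) xs"
  note wb = word_bound_reduction[OF us vs, where c=c and b=b, folded out xs]
  have "reaches ?W (reduction_prog b) (initial_state xs) (60 * length out) (\<lambda>s. s = initial_state out)"
    using reduction_prog[OF us vs, where b=b, folded out xs] wb(2) by blast
  then obtain t0 where "exec ?W (reduction_prog b) (initial_state xs) t0 (initial_state out)"
    "t0 \<le> 60 * length out"
    unfolding reaches_def by blast
  with exec_mono_word[OF A wb(1)] show ?thesis
    by (intro exI[of _ "t0 + t"]) (auto intro: exec.Seq)
qed

section \<open>From a safety algorithm to one for orthogonal vectors\<close>

text \<open>Converts a computed winning set into a yes/no answer by looking only at the output
  length in register 0, hence in constant time.\<close>

definition nonempty_prog :: prog where
  "nonempty_prog = If 0 (seqs [Const 0 1, Const 1 0, Store 1 0]) (seqs [Const 0 1, Const 1 0, Store 1 1])"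

lemma nonempty_prog:
  assumes "1 < W"
  shows "reaches W nonempty_prog s 4 (\<lambda>s'. output_of s' = answer (output_of s \<noteq> []))"
proof -
  obtain R M where s: "s = (R, M)" by (cases s)
  have If: "reaches W (If r p q) s (Suc T) Q"
    if "reaches W (if fst s r \<noteq> 0 then p else q) s T Q" for r p q T Q
    using that exec.IfTrue[of s r W p _ _ q] exec.IfFalse[of s r W q _ _ p]
    unfolding reaches_def by (cases "fst s r = 0") (auto, blast+)
  have "reaches W nonempty_prog s (Suc 3) (\<lambda>s'. output_of s' = answer (output_of s \<noteq> []))"
    unfolding nonempty_prog_def
    by (rule If) (use assms in \<open>auto simp: s output_of_def answer_def\<close>)
  then show ?thesis by (simp add: eval_nat_numeral)
qed

text \<open>\<open>Q\<close> abstracts from the output format: decision algorithms already leave the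
  answer, whereas a computed winning set still needs post-processing. That the word bound exceeds 1
  is recorded for this last step.\<close>

lemma OV_exec_via_reduction:
  assumes A: "\<And>d us vs out. \<forall>u\<in>set us. bit_vector d u \<Longrightarrow> \<forall>v\<in>set vs. bit_vector d v \<Longrightarrow>
      out = (if b then [0] else []) @ ov_instance d us vs \<Longrightarrow>
      \<exists>t s. exec (word_bound c out) A (initial_state out) t s \<and>
        Q (orthogonal_pair d (set us) (set vs)) s \<and>
        real t \<le> bound (length (ov_edges d us)) (length vs) (length out)"
    and enc: "encodes_OV d S1 S2 xs"
  shows "\<exists>t s. exec (word_bound (8 * c + 10) xs) (Seq (reduction_prog b) A) (initial_state xs) t s \<and>
      Q (orthogonal_pair d S1 S2) s \<and> 1 < word_bound (8 * c + 10) xs \<and>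
      real t \<le> 60 * real (instance_length b d (card S1) (card S2)) +
        bound (card S1 * (d + 2) + 3 * d + 2) (card S2) (instance_length b d (card S1) (card S2))"
proof -
  obtain us vs where dist: "distinct us" "distinct vs" and S: "S1 = set us" "S2 = set vs"
    and xs: "xs = [d, length us, length vs] @ concat us @ concat vs"
    and us: "\<forall>u\<in>set us. bit_vector d u" and vs: "\<forall>v\<in>set vs. bit_vector d v"
    using enc unfolding encodes_OV_def bit_vector_def by blast
  have cards: "card S1 = length us" "card S2 = length vs"
    using dist S by (simp_all add: distinct_card)
  define out where "out = (if b then [0] else []) @ ov_instance d us vs"
  have len: "length out = instance_length b d (length us) (length vs)"
    by (simp only: out_def length_reduction_out)
  obtain t s where ex: "exec (word_bound c out) A (initial_state out) t s"
    and Q: "Q (orthogonal_pair d S1 S2) s"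
    and t: "real t \<le> bound (length (ov_edges d us)) (length vs) (length out)"
    using A[OF us vs out_def] S by blast
  obtain t' where t': "exec (word_bound (8 * c + 10) xs) (Seq (reduction_prog b) A) (initial_state xs) t' s"
    "t' \<le> 60 * length out + t"
    using exec_after_reduction[OF us vs ex out_def xs] by blast
  have "1 < word_bound (8 * c + 10) xs"
    using word_bound_reduction(2)[OF us vs, where b=b and c=c] xs by simp
  moreover have "real t' \<le> 60 * real (instance_length b d (card S1) (card S2)) +
      bound (card S1 * (d + 2) + 3 * d + 2) (card S2) (instance_length b d (card S1) (card S2))"
    using t t'(2) unfolding cards length_ov_edges len by linarith
  ultimately show ?thesis
    using t'(1) Q by blast
qed

text \<open>Membership is asked for the start vertex, so it takes \<open>b = True\<close>; the other
  two problems take \<open>b = False\<close>. The summand \<open>4\<close> pays for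
  \<open>nonempty_prog\<close>.\<close>

lemma OV_algorithm_from_disj_safety:
  assumes win: "win \<in> {disj_objective_win, disj_query_win}"
    and solves: "solves \<in> {computes_winning_set win, decides_nonempty win, decides_membership win}"
    and A: "solves A c bound"
  obtains b A' c' where
    "\<And>d S1 S2 xs. encodes_OV d S1 S2 xs \<Longrightarrow>
      \<exists>t s. exec (word_bound c' xs) A' (initial_state xs) t s \<and>
        output_of s = answer (orthogonal_pair d S1 S2) \<and>
        real t \<le> 60 * real (instance_length b d (card S1) (card S2)) +
          bound (card S1 * (d + 2) + 3 * d + 2) (card S2) (instance_length b d (card S1) (card S2)) + 4"
proof -
  let ?Ts = "\<lambda>d vs. map (\<lambda>v. set (ov_target_list d v)) vs"
  consider (compute) "solves = computes_winning_set win" | (nonempty) "solves = decides_nonempty win"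
    | (membership) "solves = decides_membership win"
    using solves by blast
  then show thesis
  proof cases
    case compute
    have "\<exists>t s. exec (word_bound c out) A (initial_state out) t s \<and>
        (output_of s \<noteq> [] \<longleftrightarrow> orthogonal_pair d (set us) (set vs)) \<and>
        real t \<le> bound (length (ov_edges d us)) (length vs) (length out)"
      if us: "\<forall>u\<in>set us. bit_vector d u" and vs: "\<forall>v\<in>set vs. bit_vector d v"
        and out: "out = (if False then [0] else []) @ ov_instance d us vs" for d us vs out
    proof -
      have "encodes_instance (ov_mdp d us) (?Ts d vs) out"
        using encodes_ov_instance[OF us vs] out by simp
      then obtain t s where "exec (word_bound c out) A (initial_state out) t s"
        and o: "set (output_of s) = win (ov_mdp d us) (?Ts d vs)"
        and "real t \<le> bound (card (edges (ov_mdp d us))) (length (?Ts d vs)) (length out)"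
        using A[unfolded compute computes_winning_set_def solves_within_def, rule_format, of "(ov_mdp d us, ?Ts d vs)" out] by auto
      moreover have "output_of s \<noteq> [] \<longleftrightarrow> orthogonal_pair d (set us) (set vs)"
        using ov_mdp_win(1)[OF us vs win] o by (metis set_empty)
      ultimately show ?thesis
        by (intro exI[of _ t] exI[of _ s]) (simp add: card_ov_mdp_edges[OF us])
    qed
    note run = OV_exec_via_reduction[where b=False and Q="\<lambda>r s. output_of s \<noteq> [] \<longleftrightarrow> r", OF this]
    show thesis
    proof (rule that)
      fix d S1 S2 xs assume "encodes_OV d S1 S2 xs"
      from run[OF _ _ _ this] obtain t s where
        t: "exec (word_bound (8 * c + 10) xs) (Seq (reduction_prog False) A) (initial_state xs) t s"
        "output_of s \<noteq> [] \<longleftrightarrow> orthogonal_pair d S1 S2" "1 < word_bound (8 * c + 10) xs"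
        "real t \<le> 60 * real (instance_length False d (card S1) (card S2)) +
          bound (card S1 * (d + 2) + 3 * d + 2) (card S2) (instance_length False d (card S1) (card S2))"
        by blast
      from nonempty_prog[OF t(3), of s] obtain t2 s2 where
        t2: "exec (word_bound (8 * c + 10) xs) nonempty_prog s t2 s2" "t2 \<le> 4"
        "output_of s2 = answer (output_of s \<noteq> [])"
        unfolding reaches_def by blast
      show "\<exists>t s. exec (word_bound (8 * c + 10) xs) (Seq (Seq (reduction_prog False) A) nonempty_prog)
          (initial_state xs) t s \<and> output_of s = answer (orthogonal_pair d S1 S2) \<and>
          real t \<le> 60 * real (instance_length False d (card S1) (card S2)) +
            bound (card S1 * (d + 2) + 3 * d + 2) (card S2) (instance_length False d (card S1) (card S2)) + 4"
        using exec.Seq[OF t(1) t2(1)] t2(2,3) t(2,4)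
        by (intro exI[of _ "t + t2"] exI[of _ s2]) auto
    qed
  next
    case nonempty
    have "\<exists>t s. exec (word_bound c out) A (initial_state out) t s \<and>
        output_of s = answer (orthogonal_pair d (set us) (set vs)) \<and>
        real t \<le> bound (length (ov_edges d us)) (length vs) (length out)"
      if us: "\<forall>u\<in>set us. bit_vector d u" and vs: "\<forall>v\<in>set vs. bit_vector d v"
        and out: "out = (if False then [0] else []) @ ov_instance d us vs" for d us vs out
    proof -
      have "encodes_instance (ov_mdp d us) (?Ts d vs) out"
        using encodes_ov_instance[OF us vs] out by simp
      then obtain t s where "exec (word_bound c out) A (initial_state out) t s"
        and "output_of s = answer (win (ov_mdp d us) (?Ts d vs) \<noteq> {})"
        and "real t \<le> bound (card (edges (ov_mdp d us))) (length (?Ts d vs)) (length out)"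
        using A[unfolded nonempty decides_nonempty_def solves_within_def, rule_format, of "(ov_mdp d us, ?Ts d vs)" out] by auto
      then show ?thesis
        using ov_mdp_win(1)[OF us vs win]
        by (intro exI[of _ t] exI[of _ s]) (simp add: card_ov_mdp_edges[OF us])
    qed
    note run = OV_exec_via_reduction[where b=False and Q="\<lambda>r s. output_of s = answer r", OF this]
    show thesis
      by (rule that[where b=False], drule run[rotated 3])
        (assumption | elim exE conjE, intro exI conjI, assumption, assumption, linarith)+
  next
    case membership
    have "\<exists>t s. exec (word_bound c out) A (initial_state out) t s \<and>
        output_of s = answer (orthogonal_pair d (set us) (set vs)) \<and>
        real t \<le> bound (length (ov_edges d us)) (length vs) (length out)"
      if us: "\<forall>u\<in>set us. bit_vector d u" and vs: "\<forall>v\<in>set vs. bit_vector d v"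
        and out: "out = (if True then [0] else []) @ ov_instance d us vs" for d us vs out
    proof -
      have "encodes_instance (ov_mdp d us) (?Ts d vs) (ov_instance d us vs)" "out = 0 # ov_instance d us vs"
        "0 \<in> verts (ov_mdp d us)"
        using encodes_ov_instance[OF us vs] out by (simp_all add: ov_mdp_def)
      then obtain t s where "exec (word_bound c out) A (initial_state out) t s"
        and "output_of s = answer (0 \<in> win (ov_mdp d us) (?Ts d vs))"
        and "real t \<le> bound (card (edges (ov_mdp d us))) (length (?Ts d vs)) (length out)"
        using A[unfolded membership decides_membership_def solves_within_def, rule_format, of "(ov_mdp d us, ?Ts d vs, 0)" out] by auto
      then show ?thesis
        using ov_mdp_win(2)[OF us vs win]
        by (intro exI[of _ t] exI[of _ s]) (simp add: card_ov_mdp_edges[OF us])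
    qed
    note run = OV_exec_via_reduction[where b=True and Q="\<lambda>r s. output_of s = answer r", OF this]
    show thesis
      by (rule that[where b=True], drule run[rotated 3])
        (assumption | elim exE conjE, intro exI conjI, assumption, assumption, linarith)+
  qed
qed

section \<open>Asymptotic estimates\<close>

text \<open>The finitely many arguments before the asymptotic bound sets in are absorbed by the sum
  \<open>S\<close>. The base is \<open>1 + real m\<close> because \<open>0 powr a = 0\<close> would
  force \<open>f 0 \<le> 0\<close>. A larger exponent \<open>a'\<close> is allowed since
  \<open>a\<close> may be negative.\<close>

lemma bigo_powr_global_bound:
  fixes f :: "nat \<Rightarrow> real"
  assumes "f \<in> O(\<lambda>m. real m powr a)" "a \<le> a'" "0 \<le> a'"
  obtains K where "0 \<le> K" "\<And>m. f m \<le> K * (1 + real m) powr a'"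
proof -
  obtain C where "C > 0" and "\<forall>\<^sub>F m in at_top. norm (f m) \<le> C * norm (real m powr a)"
    using assms(1) by (elim landau_o.bigE)
  then obtain m0 where m0: "\<And>m. m \<ge> m0 \<Longrightarrow> \<bar>f m\<bar> \<le> C * real m powr a"
    by (auto simp: eventually_at_top_linorder)
  define S where "S = (\<Sum>m<Suc m0. \<bar>f m\<bar>)"
  have S: "0 \<le> S" by (simp add: S_def sum_nonneg)
  have "f m \<le> (C + S) * (1 + real m) powr a'" for m
  proof (cases "m < Suc m0")
    case True
    then have "\<bar>f m\<bar> \<le> S"
      unfolding S_def by (intro member_le_sum) auto
    also have "S \<le> S * (1 + real m) powr a'"
      using S assms(3) by (simp add: mult_le_cancel_left1 ge_one_powr_ge_zero)
    also have "\<dots> \<le> (C + S) * (1 + real m) powr a'"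
      using \<open>C > 0\<close> by (intro mult_right_mono) auto
    finally show ?thesis by simp
  next
    case False
    have "\<bar>f m\<bar> \<le> C * real m powr a"
      using False by (intro m0) simp
    also have "\<dots> \<le> C * (1 + real m) powr a'"
    proof (intro mult_left_mono)
      have "real m powr a \<le> real m powr a'"
        using False assms(2) by (intro powr_mono) auto
      also have "\<dots> \<le> (1 + real m) powr a'"
        using assms(3) by (intro powr_mono2) auto
      finally show "real m powr a \<le> (1 + real m) powr a'" .
    qed (use \<open>C > 0\<close> in simp)
    also have "\<dots> \<le> (C + S) * (1 + real m) powr a'"
      using S by (intro mult_right_mono) auto
    finally show ?thesis by simp
  qed
  with that[of "C + S"] \<open>C > 0\<close> S show thesis by simp
qed

lemma real_powr_bigo_mono:
  "p \<le> q \<Longrightarrow> (\<lambda>N. real N powr p) \<in> O(\<lambda>N. real N powr q)"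
  by (intro bigoI[of _ 1] eventually_mono[OF eventually_ge_at_top[of 1]]) (auto intro: powr_mono)

text \<open>The logarithmic dimension costs only an arbitrarily small power, by
  \<open>ln N \<le> N powr \<eta> / \<eta>\<close>.\<close>

lemma log_dimension_size_bigo:
  assumes "(\<lambda>N. real (d N)) \<in> \<Theta>(\<lambda>N. ln (real N))" "\<eta> > 0"
  shows "(\<lambda>N. real ((N + 1) * (d N + 1))) \<in> O(\<lambda>N. real N powr (1 + \<eta>))"
proof -
  have "(\<lambda>N. ln (real N)) \<in> O(\<lambda>N. real N powr \<eta>)"
  proof (intro bigoI[of _ "1 / \<eta>"] eventually_mono[OF eventually_ge_at_top[of 1]])
    fix N :: nat assume "1 \<le> N"
    then show "norm (ln (real N)) \<le> 1 / \<eta> * norm (real N powr \<eta>)"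
      using ln_powr_bound[of "real N" \<eta>] assms(2) by simp
  qed
  with assms(1) have "(\<lambda>N. real (d N)) \<in> O(\<lambda>N. real N powr \<eta>)"
    by (meson bigthetaD1 landau_o.big_trans)
  moreover have "(\<lambda>N. 1 :: real) \<in> O(\<lambda>N. real N powr \<eta>)"
    using assms(2)
    by (intro bigoI[of _ 1] eventually_mono[OF eventually_ge_at_top[of 1]])
      (auto simp: ge_one_powr_ge_zero)
  ultimately have "(\<lambda>N. real (d N) + 1) \<in> O(\<lambda>N. real N powr \<eta>)"
    by (rule sum_in_bigo)
  moreover have "(\<lambda>N. real N + 1) \<in> O(\<lambda>N. real N powr 1)"
    by (intro bigoI[of _ 2] eventually_mono[OF eventually_ge_at_top[of 1]]) auto
  ultimately have "(\<lambda>N. (real N + 1) * (real (d N) + 1)) \<in> O(\<lambda>N. real N powr 1 * real N powr \<eta>)"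
    by (intro landau_o.big.mult)
  then show ?thesis
    by (simp add: powr_add algebra_simps)
qed

text \<open>The order of quantifiers matches the conjecture: one program serves all dimensions
  \<open>d\<close>, while the time bound \<open>f\<close> may depend on \<open>d\<close>. As
  \<open>b\<close> is only obtained inside the proof, \<open>fast\<close> has to cover both
  values.\<close>

lemma no_fast_disj_safety:
  assumes ovc: "orthogonal_vectors_conjecture"
    and win: "win \<in> {disj_objective_win, disj_query_win}"
    and solves: "solves \<in> {computes_winning_set win, decides_nonempty win, decides_membership win}"
    and A: "solves A c bound"
    and \<delta>: "\<delta> > 0"
    and fast: "\<And>d b. (\<lambda>N. real (d N)) \<in> \<Theta>(\<lambda>N. ln (real N)) \<Longrightarrow>
      \<exists>f. f \<in> O(\<lambda>N. real N powr (2 - \<delta>)) \<and>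
        (\<forall>N n1 n2. n1 \<le> N \<longrightarrow> n2 \<le> N \<longrightarrow>
           60 * real (instance_length b (d N) n1 n2) +
           bound (n1 * (d N + 2) + 3 * d N + 2) n2 (instance_length b (d N) n1 n2) + 4 \<le> f N)"
  shows False
proof -
  obtain b A' c' where A': "\<And>d S1 S2 xs. encodes_OV d S1 S2 xs \<Longrightarrow>
      \<exists>t s. exec (word_bound c' xs) A' (initial_state xs) t s \<and>
        output_of s = answer (orthogonal_pair d S1 S2) \<and>
        real t \<le> 60 * real (instance_length b d (card S1) (card S2)) +
          bound (card S1 * (d + 2) + 3 * d + 2) (card S2) (instance_length b d (card S1) (card S2)) + 4"
    by (rule OV_algorithm_from_disj_safety[OF win solves A]) (erule that)
  have "\<exists>f :: nat \<Rightarrow> real. f \<in> O(\<lambda>N. real N powr (2 - \<delta>)) \<and>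
      solves_within A' c'
        (\<lambda>(N, S1, S2) xs. card S1 \<le> N \<and> card S2 \<le> N \<and> encodes_OV (d N) S1 S2 xs)
        (\<lambda>(N, S1, S2) out. out = answer (orthogonal_pair (d N) S1 S2))
        (\<lambda>(N, S1, S2) xs. f N)"
    if d: "(\<lambda>N. real (d N)) \<in> \<Theta>(\<lambda>N. ln (real N))" for d :: "nat \<Rightarrow> nat"
  proof -
    obtain f where f: "f \<in> O(\<lambda>N. real N powr (2 - \<delta>))"
      and le: "\<And>N n1 n2. n1 \<le> N \<Longrightarrow> n2 \<le> N \<Longrightarrow>
           60 * real (instance_length b (d N) n1 n2) +
           bound (n1 * (d N + 2) + 3 * d N + 2) n2 (instance_length b (d N) n1 n2) + 4 \<le> f N"
      using fast[OF d, of b] by blast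
    have "\<exists>t s. exec (word_bound c' xs) A' (initial_state xs) t s \<and>
        output_of s = answer (orthogonal_pair (d N) S1 S2) \<and> real t \<le> f N"
      if card: "card S1 \<le> N" "card S2 \<le> N" and enc: "encodes_OV (d N) S1 S2 xs" for N S1 S2 xs
    proof -
      obtain t s where "exec (word_bound c' xs) A' (initial_state xs) t s"
        "output_of s = answer (orthogonal_pair (d N) S1 S2)"
        "real t \<le> 60 * real (instance_length b (d N) (card S1) (card S2)) +
          bound (card S1 * (d N + 2) + 3 * d N + 2) (card S2)
            (instance_length b (d N) (card S1) (card S2)) + 4"
        using A'[OF enc] by blast
      with le[OF card] show ?thesis
        by (intro exI[of _ t] exI[of _ s] conjI) (assumption | linarith)+
    qed
    then show ?thesis
      using f unfolding solves_within_def by (intro exI[of _ f]) auto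
  qed
  with ovc \<delta> show False
    unfolding orthogonal_vectors_conjecture_def by blast
qed

text \<open>All sizes are compared with the single quantity \<open>y\<close>; the added ones keep it
  at least 1 even if \<open>N\<close> or \<open>d\<close> is 0, so that additive constants are
  absorbed.\<close>

lemma instance_size_bounds:
  fixes N n1 n2 d :: nat
  assumes "n1 \<le> N" "n2 \<le> N"
  defines "y \<equiv> real ((N + 1) * (d + 1))"
  shows "real (n1 * (d + 2) + 3 * d + 2) \<le> 3 * y"
    and "real (instance_length b d n1 n2) \<le> 20 * y"
    and "1 \<le> y"
proof -
  have a: "n1 * (d + 2) \<le> N * (d + 2)" "n2 * (d + 2) \<le> N * (d + 2)"
    using assms by (intro mult_le_mono; simp)+
  then have "n1 * (d + 2) + 3 * d + 2 \<le> 3 * ((N + 1) * (d + 1))"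
    by (simp add: algebra_simps)
  then show "real (n1 * (d + 2) + 3 * d + 2) \<le> 3 * y"
    unfolding y_def by (metis of_nat_le_iff of_nat_mult of_nat_numeral)
  have "instance_length b d n1 n2 \<le> 20 * ((N + 1) * (d + 1))"
    using a assms(1) unfolding instance_length_def by (simp add: algebra_simps)
  then show "real (instance_length b d n1 n2) \<le> 20 * y"
    unfolding y_def by (metis of_nat_le_iff of_nat_mult of_nat_numeral)
  show "1 \<le> y"
    by (simp add: y_def)
qed

text \<open>The factor 4 comes from \<open>1 + 3 * y \<le> 4 * y\<close>, where \<open>3 * y\<close>
  bounds the number of edges.\<close>

lemma powr_size_bigo:
  fixes g :: "nat \<Rightarrow> real"
  assumes "g \<in> O(\<lambda>N. real N powr p)" "\<And>N. 0 \<le> g N" "0 \<le> q" "p * q \<le> r"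
  shows "(\<lambda>N. (4 * g N) powr q) \<in> O(\<lambda>N. real N powr r)"
proof -
  have "(\<lambda>N. (4 * g N) powr q) \<in> O(\<lambda>N. (real N powr p) powr q)"
    using assms(1-3) by (intro bigo_powr_nonneg) auto
  also have "(\<lambda>N. (real N powr p) powr q) \<in> O(\<lambda>N. real N powr r)"
    using real_powr_bigo_mono[OF assms(4)] by (simp add: powr_powr)
  finally show ?thesis .
qed

theorem theorem5:
  fixes \<epsilon> \<kappa> :: real
  assumes "orthogonal_vectors_conjecture"
    and "\<epsilon> > 0"
    and "win \<in> {disj_objective_win, disj_query_win}"
    and "solves \<in> {computes_winning_set win, decides_nonempty win, decides_membership win}"
  shows "\<not> (\<exists>A c f. f \<in> O(\<lambda>m. real m powr (2 - \<epsilon>)) \<and>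
              solves A c (\<lambda>m k l. f m + \<kappa> * real l)) \<and>
         \<not> (\<exists>A c f. f \<in> O(\<lambda>j. real j powr (1 - \<epsilon>)) \<and>
              solves A c (\<lambda>m k l. f (k * m) + \<kappa> * real l))"
proof -
  \<comment> \<open>Shrinking the exponent gap only weakens the assumed time bound, and it makes
    \<open>2 - e\<close> and \<open>1 - e\<close> positive, as monotonicity of \<open>powr\<close>
    in the base requires.\<close>
  define e where "e = min \<epsilon> (1 / 2)"
  have e: "0 < e" "e \<le> 1 / 2" "e \<le> \<epsilon>"
    using assms(2) by (auto simp: e_def)
  have e2: "0 \<le> e * e" by simp
  define y where "y d N = real ((N + 1) * (d N + 1))" for d :: "nat \<Rightarrow> nat" and N
  have y: "y d \<in> O(\<lambda>N. real N powr (1 + e / 4))"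
    if "(\<lambda>N. real (d N)) \<in> \<Theta>(\<lambda>N. ln (real N))" for d
    using log_dimension_size_bigo[OF that, of "e / 4"] e unfolding y_def by simp
  have y0: "0 \<le> y d N" for d N
    by (simp add: y_def)
  \<comment> \<open>The share linear in the instance length, which is at most \<open>20 * y\<close>:
    the reduction contributes \<open>60 * 20 = 1200\<close>, the granted linear time
    \<open>\<bar>\<kappa>\<bar> * 20\<close>. The absolute value is taken because
    \<open>\<kappa>\<close> may be negative.\<close>
  have lin: "(\<lambda>N. (1200 + \<bar>\<kappa>\<bar> * 20) * y d N + 4) \<in> O(\<lambda>N. real N powr (2 - e / 2))"
    if "(\<lambda>N. real (d N)) \<in> \<Theta>(\<lambda>N. ln (real N))" for d
  proof -
    have "y d \<in> O(\<lambda>N. real N powr (2 - e / 2))"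
      using y[OF that] by (rule landau_o.big_trans) (use e in \<open>auto intro!: real_powr_bigo_mono\<close>)
    moreover have "(\<lambda>N. 4 :: real) \<in> O(y d)"
      by (intro bigoI[of _ 4] always_eventually allI) (simp add: y_def)
    ultimately show ?thesis
      by (intro sum_in_bigo) (auto intro: landau_o.big_trans)
  qed
  have linear_part: "60 * real l + \<kappa> * real l + 4 \<le> (1200 + \<bar>\<kappa>\<bar> * 20) * z + 4"
    if "real l \<le> 20 * z" for l z
  proof -
    have "\<kappa> * real l \<le> \<bar>\<kappa>\<bar> * real l" by (intro mult_right_mono) auto
    also have "\<dots> \<le> \<bar>\<kappa>\<bar> * (20 * z)" using that by (intro mult_left_mono) auto
    finally show ?thesis using that by (simp add: algebra_simps)
  qed
  have "False" if f: "f \<in> O(\<lambda>m. real m powr (2 - \<epsilon>))" and A: "solves A c (\<lambda>m k l. f m + \<kappa> * real l)"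
    for A c f
  proof -
    obtain K where K: "0 \<le> K" "\<And>m. f m \<le> K * (1 + real m) powr (2 - e)"
      using bigo_powr_global_bound[OF f, of "2 - e"] e by auto
    show False
    proof (rule no_fast_disj_safety[OF assms(1,3,4) A, of "e / 2"])
      fix d :: "nat \<Rightarrow> nat" and b
      assume d: "(\<lambda>N. real (d N)) \<in> \<Theta>(\<lambda>N. ln (real N))"
      let ?F = "\<lambda>N. K * (4 * y d N) powr (2 - e) + ((1200 + \<bar>\<kappa>\<bar> * 20) * y d N + 4)"
      \<comment> \<open>The product is \<open>2 - e / 2 - e * e / 4\<close>: the slack
        \<open>e / 4\<close> spent on the logarithm uses up only half of the gap
        \<open>e\<close>.\<close>
      have "(1 + e / 4) * (2 - e) \<le> 2 - e / 2"
        using e2 by (simp add: algebra_simps)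
      then have "(\<lambda>N. (4 * y d N) powr (2 - e)) \<in> O(\<lambda>N. real N powr (2 - e / 2))"
        using y[OF d] e by (intro powr_size_bigo) (auto simp: y0)
      then have "?F \<in> O(\<lambda>N. real N powr (2 - e / 2))"
        by (intro sum_in_bigo(1)[OF _ lin[OF d]]) simp
      moreover have "60 * real (instance_length b (d N) n1 n2) +
          (f (n1 * (d N + 2) + 3 * d N + 2) + \<kappa> * real (instance_length b (d N) n1 n2)) + 4 \<le> ?F N"
        if "n1 \<le> N" "n2 \<le> N" for N n1 n2
      proof -
        note sz = instance_size_bounds[OF that, where d="d N", folded y_def]
        have "f (n1 * (d N + 2) + 3 * d N + 2) \<le>
            K * (1 + real (n1 * (d N + 2) + 3 * d N + 2)) powr (2 - e)"
          by (rule K(2))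
        also have "\<dots> \<le> K * (4 * y d N) powr (2 - e)"
          using K(1) sz(1,3) e by (intro mult_left_mono powr_mono2) linarith+
        finally show ?thesis
          using linear_part[OF sz(2)[where b=b]] by linarith
      qed
      ultimately show "\<exists>g. g \<in> O(\<lambda>N. real N powr (2 - e / 2)) \<and>
        (\<forall>N n1 n2. n1 \<le> N \<longrightarrow> n2 \<le> N \<longrightarrow>
           60 * real (instance_length b (d N) n1 n2) +
           (f (n1 * (d N + 2) + 3 * d N + 2) + \<kappa> * real (instance_length b (d N) n1 n2)) + 4 \<le> g N)"
        by blast
    qed (use e in simp)
  qed
  moreover have "False" if f: "f \<in> O(\<lambda>j. real j powr (1 - \<epsilon>))"
    and A: "solves A c (\<lambda>m k l. f (k * m) + \<kappa> * real l)" for A c f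
  proof -
    obtain K where K: "0 \<le> K" "\<And>m. f m \<le> K * (1 + real m) powr (1 - e)"
      using bigo_powr_global_bound[OF f, of "1 - e"] e by auto
    show False
    proof (rule no_fast_disj_safety[OF assms(1,3,4) A, of "e / 2"])
      fix d :: "nat \<Rightarrow> nat" and b
      assume d: "(\<lambda>N. real (d N)) \<in> \<Theta>(\<lambda>N. ln (real N))"
      let ?F = "\<lambda>N. K * (4 * ((real N + 1) * y d N)) powr (1 - e) +
        ((1200 + \<bar>\<kappa>\<bar> * 20) * y d N + 4)"
      have "(\<lambda>N. real N + 1) \<in> O(\<lambda>N. real N powr 1)"
        by (intro bigoI[of _ 2] eventually_mono[OF eventually_ge_at_top[of 1]]) auto
      then have "(\<lambda>N. (real N + 1) * y d N) \<in> O(\<lambda>N. real N powr 1 * real N powr (1 + e / 4))"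
        using y[OF d] by (rule landau_o.big.mult)
      moreover have "real N powr 1 * real N powr (1 + e / 4) = real N powr (2 + e / 4)" for N
        unfolding powr_add[symmetric] by simp
      ultimately have "(\<lambda>N. (real N + 1) * y d N) \<in> O(\<lambda>N. real N powr (2 + e / 4))"
        by (simp only:)
      \<comment> \<open>Here \<open>k * m\<close> is of order \<open>N powr (2 + e / 4)\<close>, and
        the product is \<open>2 - 7 * e / 4 - e * e / 4\<close>.\<close>
      moreover have "(2 + e / 4) * (1 - e) \<le> 2 - e / 2"
        using e2 e by (simp add: algebra_simps)
      ultimately have "(\<lambda>N. (4 * ((real N + 1) * y d N)) powr (1 - e)) \<in> O(\<lambda>N. real N powr (2 - e / 2))"
        using e by (intro powr_size_bigo) (auto simp: y0)
      then have "?F \<in> O(\<lambda>N. real N powr (2 - e / 2))"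
        by (intro sum_in_bigo(1)[OF _ lin[OF d]]) simp
      moreover have "60 * real (instance_length b (d N) n1 n2) +
          (f (n2 * (n1 * (d N + 2) + 3 * d N + 2)) + \<kappa> * real (instance_length b (d N) n1 n2)) + 4 \<le> ?F N"
        if "n1 \<le> N" "n2 \<le> N" for N n1 n2
      proof -
        note sz = instance_size_bounds[OF that, where d="d N", folded y_def]
        \<comment> \<open>The number of target sets is \<open>n2 \<le> N\<close>, and the number of
          edges is at most \<open>3 * y d N\<close>.\<close>
        have "real (n2 * (n1 * (d N + 2) + 3 * d N + 2)) \<le> real N * (3 * y d N)"
          unfolding of_nat_mult[of n2] using that sz(1) by (intro mult_mono) auto
        moreover have "1 + real N * (3 * y d N) \<le> 4 * ((real N + 1) * y d N)"
        proof -
          have "0 \<le> real N * y d N" using sz(3) by (intro mult_nonneg_nonneg) auto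
          moreover have "4 * ((real N + 1) * y d N) =
              real N * (3 * y d N) + real N * y d N + 4 * y d N"
            by (simp add: algebra_simps)
          ultimately show ?thesis using sz(3) by linarith
        qed
        ultimately have le: "1 + real (n2 * (n1 * (d N + 2) + 3 * d N + 2)) \<le> 4 * ((real N + 1) * y d N)"
          by linarith
        have "f (n2 * (n1 * (d N + 2) + 3 * d N + 2)) \<le>
            K * (1 + real (n2 * (n1 * (d N + 2) + 3 * d N + 2))) powr (1 - e)"
          by (rule K(2))
        also have "\<dots> \<le> K * (4 * ((real N + 1) * y d N)) powr (1 - e)"
          using K(1) le e by (intro mult_left_mono powr_mono2) auto
        finally show ?thesis
          using linear_part[OF sz(2)[where b=b]] by linarith
      qed
      ultimately show "\<exists>g. g \<in> O(\<lambda>N. real N powr (2 - e / 2)) \<and>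
        (\<forall>N n1 n2. n1 \<le> N \<longrightarrow> n2 \<le> N \<longrightarrow>
           60 * real (instance_length b (d N) n1 n2) +
           (f (n2 * (n1 * (d N + 2) + 3 * d N + 2)) + \<kappa> * real (instance_length b (d N) n1 n2)) + 4 \<le> g N)"
        by blast
    qed (use e in simp)
  qed
  ultimately show ?thesis by blast
qed

end
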